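(* Let $(\mathcal{F}_q(G),* )$ be a real quantum group. (a) Let $(\mathcal{F}_q(K),\tau_K)$ be a real coisotropic quantum left subgroup of $(\mathcal{F}_q(G),* )$, with projection $\pi:\mathcal{F}_q(G)\to\mathcal{F}_q(K)$. Then $$B_\pi=\{a\in\mathcal{F}_q(G)\;:\;(\pi\otimes\mathrm{id})\Delta a=\pi(1)\otimes a\}$$ is a left embeddable quantum homogeneous space (with the inclusion into $\mathcal{F}_q(G)$ and the coaction obtained by restricting $\Delta$); that is, $B_\pi$ is a $*$-subalgebra and a right coideal of $\mathcal{F}_q(G)$. (b) Let $(\mathcal{F}_q(K),\tau_K)$ be a real coisotropic quantum right subgroup of $(\mathcal{F}_q(G),* )$, with projection $\pi:\mathcal{F}_q(G)\to\mathcal{F}_q(K)$. Then $$B^\pi=\{a\in\mathcal{F}_q(G)\;:\;(\mathrm{id}\otimes\pi)\Delta a=a\otimes\pi(1)\}$$ is a right embeddable quantum homogeneous space (with the inclusion into $\mathcal{F}_q(G)$ and the coaction obtained by restricting $\Delta$); that is, $B^\pi$ is a $*$-subalgebra and a left coideal of $\mathcal{F}_q(G)$.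
   Context: A real quantum group $(\mathcal{F}_q(G),* )$ is a Hopf $*$-algebra over $\mathbb{C}$, with coproduct $\Delta$, counit $\epsilon$, antipode $S$; put $\tau=*\circ S$, i.e. $\tau(a)=S(a)^*$ (with the standard Hopf $*$-algebra axiom $\tau^2=\mathrm{id}$, so $S$ is invertible). A real coisotropic quantum right (resp. left) subgroup $(\mathcal{F}_q(K),\tau_K)$ of $(\mathcal{F}_q(G),* )$ is a coalgebra $\mathcal{F}_q(K)$ which is also a right (resp. left) $\mathcal{F}_q(G)$-module, such that: (i) there is a surjective linear map $\pi:\mathcal{F}_q(G)\to\mathcal{F}_q(K)$ that is a morphism of coalgebras and of right (resp. left) $\mathcal{F}_q(G)$-modules, where $\mathcal{F}_q(G)$ is a module over itself by multiplication; (ii) there is an antilinear map $\tau_K:\mathcal{F}_q(K)\to\mathcal{F}_q(K)$ with $\tau_K\circ\pi=\pi\circ\tau$. A $*$-algebra $B$ is a left (resp. right) embeddable quantum homogeneous space of $\mathcal{F}_q(G)$ if there are a coaction $\delta:B\to B\otimes\mathcal{F}_q(G)$ (resp. $\delta:B\to\mathcal{F}_q(G)\otimes B$) and an injective morphism of $*$-algebras $i:B\to\mathcal{F}_q(G)$ with $\Delta\circ i=(i\otimes\mathrm{id})\circ\delta$ (resp. $\Delta\circ i=(\mathrm{id}\otimes i)\circ\delta$). Left (resp. right) embeddable homogeneous spaces are identified with $*$-subalgebras that are right (resp. left) coideals of $\mathcal{F}_q(G)$, where a right coideal is a subspace $B$ with $\Delta(B)\subset B\otimes\mathcal{F}_q(G)$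 and a left coideal is a subspace $B$ with $\Delta(B)\subset\mathcal{F}_q(G)\otimes B$. *)

theory Defs
  imports Complex_Main "HOL-Library.Poly_Mapping"
begin

section \<open>Complex vector spaces and algebras\<close>

class complex_vector = ab_group_add +
  fixes scaleC :: "complex \<Rightarrow> 'a \<Rightarrow> 'a" (infixr "*\<^sub>C" 75)
  assumes scaleC_add_right: "c *\<^sub>C (x + y) = c *\<^sub>C x + c *\<^sub>C y"
    and scaleC_add_left: "(c + d) *\<^sub>C x = c *\<^sub>C x + d *\<^sub>C x"
    and scaleC_scaleC: "c *\<^sub>C d *\<^sub>C x = (c * d) *\<^sub>C x"
    and scaleC_one [simp]: "1 *\<^sub>C x = x"

global_interpretation complex_vector: vector_space "scaleC :: complex \<Rightarrow> 'a \<Rightarrow> 'a::complex_vector"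
  by unfold_locales (simp_all add: scaleC_add_right scaleC_add_left scaleC_scaleC)

global_interpretation complex_vector: vector_space_pair
  "scaleC :: complex \<Rightarrow> 'a \<Rightarrow> 'a::complex_vector" "scaleC :: complex \<Rightarrow> 'b \<Rightarrow> 'b::complex_vector"
  by unfold_locales

class complex_algebra_1 = complex_vector + ring_1 +
  assumes mult_scaleC_left: "(c *\<^sub>C x) * y = c *\<^sub>C (x * y)"
    and mult_scaleC_right: "x * (c *\<^sub>C y) = c *\<^sub>C (x * y)"

instantiation complex :: complex_algebra_1
begin

definition scaleC_complex_def [simp]: "c *\<^sub>C (x::complex) = c * x"

instance
  by standard (simp_all add: algebra_simps)

end

abbreviation clinear :: "('a::complex_vector \<Rightarrow> 'b::complex_vector) \<Rightarrow> bool"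
  where "clinear f \<equiv> Vector_Spaces.linear scaleC scaleC f"

definition antilinear :: "('a::complex_vector \<Rightarrow> 'b::complex_vector) \<Rightarrow> bool"
  where "antilinear f \<longleftrightarrow>
    (\<forall>x y. f (x + y) = f x + f y) \<and> (\<forall>c x. f (c *\<^sub>C x) = cnj c *\<^sub>C f x)"

definition cbilinear :: "('a::complex_vector \<Rightarrow> 'b::complex_vector \<Rightarrow> 'c::complex_vector) \<Rightarrow> bool"
  where "cbilinear f \<longleftrightarrow> (\<forall>x. clinear (f x)) \<and> (\<forall>y. clinear (\<lambda>x. f x y))"

lemma clinear_iff:
  "clinear f \<longleftrightarrow> (\<forall>x y. f (x + y) = f x + f y) \<and> (\<forall>c x. f (c *\<^sub>C x) = c *\<^sub>C f x)"
  by (auto simp: linear_iff_module_hom module_hom_iff complex_vector.module_axioms)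

section \<open>The tensor product over the complex numbers\<close>

text \<open>The free vector space on pairs, modulo the span of the bilinearity relations.\<close>

abbreviation free_scale :: "complex \<Rightarrow> ('p \<Rightarrow>\<^sub>0 complex) \<Rightarrow> ('p \<Rightarrow>\<^sub>0 complex)"
  where "free_scale c \<equiv> Poly_Mapping.map ((*) c)"

lemma lookup_free_scale: "Poly_Mapping.lookup (free_scale c f) p = c * Poly_Mapping.lookup f p"
  by transfer (simp add: when_def)

global_interpretation free_vector: vector_space "free_scale :: complex \<Rightarrow> ('p \<Rightarrow>\<^sub>0 complex) \<Rightarrow> _"
  by unfold_locales
    (rule poly_mapping_eqI, simp add: lookup_free_scale lookup_add algebra_simps)+

inductive_set tensor_relators ::
    "(('a::complex_vector \<times> 'b::complex_vector) \<Rightarrow>\<^sub>0 complex) set" where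
  "Poly_Mapping.single (x + x', y) 1 - Poly_Mapping.single (x, y) 1 - Poly_Mapping.single (x', y) 1
     \<in> tensor_relators"
| "Poly_Mapping.single (x, y + y') 1 - Poly_Mapping.single (x, y) 1 - Poly_Mapping.single (x, y') 1
     \<in> tensor_relators"
| "Poly_Mapping.single (c *\<^sub>C x, y) 1 - Poly_Mapping.single (x, y) c \<in> tensor_relators"
| "Poly_Mapping.single (x, c *\<^sub>C y) 1 - Poly_Mapping.single (x, y) c \<in> tensor_relators"

definition tensor_rel ::
    "(('a::complex_vector \<times> 'b::complex_vector) \<Rightarrow>\<^sub>0 complex) \<Rightarrow> ('a \<times> 'b \<Rightarrow>\<^sub>0 complex) \<Rightarrow> bool"
  where "tensor_rel f g \<longleftrightarrow> f - g \<in> free_vector.span tensor_relators"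

lemma equivp_tensor_rel: "equivp tensor_rel"
proof (rule equivpI)
  show "reflp tensor_rel"
    by (simp add: reflp_def tensor_rel_def free_vector.span_zero)
  show "symp tensor_rel"
  proof (rule sympI)
    fix f g
    assume "tensor_rel f g"
    then show "tensor_rel g f"
      unfolding tensor_rel_def by (subst minus_diff_eq[symmetric]) (rule free_vector.span_neg)
  qed
  show "transp tensor_rel"
  proof (rule transpI)
    fix f g h
    assume "tensor_rel f g" "tensor_rel g h"
    then show "tensor_rel f h"
      unfolding tensor_rel_def by (subst diff_add_cancel[of f g, symmetric], subst add_diff_eq[symmetric])
        (rule free_vector.span_add)
  qed
qed

quotient_type (overloaded) ('a, 'b) tensor =
    "('a::complex_vector \<times> 'b::complex_vector) \<Rightarrow>\<^sub>0 complex" / tensor_rel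
  by (rule equivp_tensor_rel)

instantiation tensor :: (complex_vector, complex_vector) complex_vector
begin

lift_definition zero_tensor :: "('a, 'b) tensor" is 0 .

lift_definition plus_tensor :: "('a, 'b) tensor \<Rightarrow> ('a, 'b) tensor \<Rightarrow> ('a, 'b) tensor" is "(+)"
  unfolding tensor_rel_def add_diff_add by (rule free_vector.span_add)

lift_definition uminus_tensor :: "('a, 'b) tensor \<Rightarrow> ('a, 'b) tensor" is "uminus"
  unfolding tensor_rel_def minus_diff_minus by (rule free_vector.span_neg)

lift_definition minus_tensor :: "('a, 'b) tensor \<Rightarrow> ('a, 'b) tensor \<Rightarrow> ('a, 'b) tensor" is "(-)"
proof -
  fix f g f' g' :: "'a \<times> 'b \<Rightarrow>\<^sub>0 complex"
  assume "tensor_rel f g" "tensor_rel f' g'"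
  then show "tensor_rel (f - f') (g - g')"
    unfolding tensor_rel_def
    using free_vector.span_diff[of "f - g" tensor_relators "f' - g'"] by (simp add: algebra_simps)
qed

lift_definition scaleC_tensor :: "complex \<Rightarrow> ('a, 'b) tensor \<Rightarrow> ('a, 'b) tensor" is free_scale
  unfolding tensor_rel_def free_vector.scale_right_diff_distrib[symmetric] by (rule free_vector.span_scale)

instance
proof
  fix a b c :: "('a, 'b) tensor" and r s :: complex
  show "a + b + c = a + (b + c)" by transfer (simp add: equivp_reflp[OF equivp_tensor_rel] add.assoc)
  show "a + b = b + a" by transfer (simp add: equivp_reflp[OF equivp_tensor_rel] add.commute)
  show "0 + a = a" by transfer (simp add: equivp_reflp[OF equivp_tensor_rel])
  show "- a + a = 0" by transfer (simp add: equivp_reflp[OF equivp_tensor_rel])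
  show "a - b = a + - b" by transfer (simp add: equivp_reflp[OF equivp_tensor_rel])
  show "r *\<^sub>C (a + b) = r *\<^sub>C a + r *\<^sub>C b"
    by transfer (simp add: equivp_reflp[OF equivp_tensor_rel] free_vector.scale_right_distrib)
  show "(r + s) *\<^sub>C a = r *\<^sub>C a + s *\<^sub>C a"
    by transfer (simp add: equivp_reflp[OF equivp_tensor_rel] free_vector.scale_left_distrib)
  show "r *\<^sub>C s *\<^sub>C a = (r * s) *\<^sub>C a"
    by transfer (simp add: equivp_reflp[OF equivp_tensor_rel])
  show "1 *\<^sub>C a = a"
    by transfer (simp add: equivp_reflp[OF equivp_tensor_rel])
qed

end

lift_definition tensor :: "'a::complex_vector \<Rightarrow> 'b::complex_vector \<Rightarrow> ('a, 'b) tensor"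
  (infixr "\<otimes>\<^sub>t" 70) is "\<lambda>x y. Poly_Mapping.single (x, y) 1" .

lemma tensor_add_left: "(x + x') \<otimes>\<^sub>t y = x \<otimes>\<^sub>t y + x' \<otimes>\<^sub>t y"
  by transfer (simp add: tensor_rel_def free_vector.span_base tensor_relators.intros(1) flip: diff_diff_add)

lemma tensor_add_right: "x \<otimes>\<^sub>t (y + y') = x \<otimes>\<^sub>t y + x \<otimes>\<^sub>t y'"
  by transfer (simp add: tensor_rel_def free_vector.span_base tensor_relators.intros(2) flip: diff_diff_add)

lemma tensor_scaleC_left: "(c *\<^sub>C x) \<otimes>\<^sub>t y = c *\<^sub>C (x \<otimes>\<^sub>t y)"
  by transfer (simp add: tensor_rel_def free_vector.span_base tensor_relators.intros(3))

lemma tensor_scaleC_right: "x \<otimes>\<^sub>t (c *\<^sub>C y) = c *\<^sub>C (x \<otimes>\<^sub>t y)"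
  by transfer (simp add: tensor_rel_def free_vector.span_base tensor_relators.intros(4))

lemma cbilinear_tensor: "cbilinear tensor"
  by (simp add: cbilinear_def clinear_iff tensor_add_left tensor_add_right
      tensor_scaleC_left tensor_scaleC_right)

lemma free_induct [case_names single add]:
  fixes f :: "'p \<Rightarrow>\<^sub>0 complex"
  assumes single: "\<And>p c. P (Poly_Mapping.single p c)"
    and add: "\<And>f g. P f \<Longrightarrow> P g \<Longrightarrow> P (f + g)"
  shows "P f"
proof (induction f rule: update_induct)
  case const
  show ?case using single[of undefined 0] by simp
next
  case (update f p c)
  have "Poly_Mapping.update p c f = f + Poly_Mapping.single p c"
    using update(1) by (intro poly_mapping_eqI)
      (auto simp: lookup_update lookup_add lookup_single when_def in_keys_iff)
  then show ?case using add[OF update(3) single] by simp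
qed

lemma tensor_induct [case_names tensor add, induct type: tensor]:
  assumes tensor: "\<And>x y. P (x \<otimes>\<^sub>t y)"
    and add: "\<And>s t. P s \<Longrightarrow> P t \<Longrightarrow> P (s + t)"
  shows "P t"
proof -
  have "P (abs_tensor f)" for f
  proof (induction f rule: free_induct)
    case (single p c)
    obtain x y where p: "p = (x, y)" by (cases p)
    have "abs_tensor (Poly_Mapping.single p c) = c *\<^sub>C (x \<otimes>\<^sub>t y)"
      by (simp add: p tensor.abs_eq scaleC_tensor.abs_eq)
    then show ?case using tensor by (simp flip: tensor_scaleC_left)
  next
    case (add f g)
    then show ?case using assms(2) by (simp flip: plus_tensor.abs_eq)
  qed
  then show ?thesis by (metis Quotient_tensor Quotient_abs_rep)
qed

text \<open>The universal property is stated for maps that are only biadditive and balanced, so that it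
  covers the linear extension of bilinear maps as well as the antilinear extension needed for the
  tensor product of two antilinear maps.  Off the balanced maps, \<open>tensor_lift\<close> is unspecified.\<close>

definition balanced ::
    "('a::complex_vector \<Rightarrow> 'b::complex_vector \<Rightarrow> 'c::ab_group_add) \<Rightarrow> bool"
  where "balanced \<beta> \<longleftrightarrow>
    (\<forall>x x' y. \<beta> (x + x') y = \<beta> x y + \<beta> x' y) \<and>
    (\<forall>x y y'. \<beta> x (y + y') = \<beta> x y + \<beta> x y') \<and>
    (\<forall>c x y. \<beta> (c *\<^sub>C x) y = \<beta> x (c *\<^sub>C y))"

definition tensor_lift ::
    "('a::complex_vector \<Rightarrow> 'b::complex_vector \<Rightarrow> 'c::ab_group_add) \<Rightarrow> ('a, 'b) tensor \<Rightarrow> 'c"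
  where "tensor_lift \<beta> = (THE h. (\<forall>s t. h (s + t) = h s + h t) \<and> (\<forall>x y. h (x \<otimes>\<^sub>t y) = \<beta> x y))"

lemma tensor_lift_exists:
  fixes \<beta> :: "'a::complex_vector \<Rightarrow> 'b::complex_vector \<Rightarrow> 'c::ab_group_add"
  assumes "balanced \<beta>"
  shows "\<exists>h. (\<forall>s t. h (s + t) = h s + h t) \<and> (\<forall>x y. h (x \<otimes>\<^sub>t y) = \<beta> x y)"
proof -
  have add1: "\<beta> (x + x') y = \<beta> x y + \<beta> x' y" and add2: "\<beta> x (y + y') = \<beta> x y + \<beta> x y'"
    and bal: "\<beta> (c *\<^sub>C x) y = \<beta> x (c *\<^sub>C y)" for x x' y y' c
    using assms by (auto simp: balanced_def)
  have zero1: "\<beta> 0 y = 0" for y using add1[of 0 0 y] by simp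
  define L where "L f = (\<Sum>p\<in>Poly_Mapping.keys f. \<beta> (Poly_Mapping.lookup f p *\<^sub>C fst p) (snd p))" for f
  have L_add: "L (f + g) = L f + L g" for f g
    unfolding L_def
    by (rule setsum_keys_plus_distrib) (simp_all add: zero1 scaleC_add_left add1)
  have L_single: "L (Poly_Mapping.single p c) = \<beta> (c *\<^sub>C fst p) (snd p)" for p c
    by (simp add: L_def zero1)
  have L_0: "L 0 = 0" by (simp add: L_def)
  have L_minus: "L (f - g) = L f - L g" for f g
    using L_add[of "f - g" g] by simp
  have scale_single: "free_scale c (Poly_Mapping.single p d) = Poly_Mapping.single p (c * d)"
    for c d and p :: "'a \<times> 'b" by (simp add: map_single)
  have L_null: "\<forall>c. L (free_scale c f) = 0" if "f \<in> free_vector.span tensor_relators" for f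
    using that
  proof (induction rule: free_vector.span_induct)
    case base
    show ?case
      by (rule free_vector.subspaceI)
        (simp_all add: L_0 L_add free_vector.scale_right_distrib)
  next
    case (step f)
    then show ?case
      by cases (auto simp: L_minus L_single free_vector.scale_right_diff_distrib scale_single
          scaleC_add_right add1 add2 bal scaleC_scaleC mult.commute)
  qed
  have L_rel: "L f = L g" if "tensor_rel f g" for f g
    using L_null[of "f - g"] that[unfolded tensor_rel_def] L_minus[of f g]
    by (metis eq_iff_diff_eq_0 free_vector.scale_one)
  define h where "h t = L (rep_tensor t)" for t
  have h_abs: "h (abs_tensor f) = L f" for f
    unfolding h_def by (rule L_rel) (rule Quotient_rep_abs[OF Quotient_tensor],
      rule equivp_reflp[OF equivp_tensor_rel])
  have abs: "\<exists>f. t = abs_tensor f" for t :: "('a, 'b) tensor"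
    by (metis Quotient_tensor Quotient_abs_rep)
  have "h (s + t) = h s + h t" for s t
    using abs[of s] abs[of t] by (auto simp: plus_tensor.abs_eq h_abs L_add)
  moreover have "h (x \<otimes>\<^sub>t y) = \<beta> x y" for x y
    by (simp add: tensor.abs_eq h_abs L_single)
  ultimately show ?thesis by blast
qed

lemma tensor_additive_unique:
  assumes "\<And>s t. h (s + t) = h s + h t" "\<And>s t. k (s + t) = k s + k t"
    and "\<And>x y. h (x \<otimes>\<^sub>t y) = k (x \<otimes>\<^sub>t y)"
  shows "h = (k :: ('a::complex_vector, 'b::complex_vector) tensor \<Rightarrow> 'c::ab_group_add)"
proof
  show "h t = k t" for t by (induction t) (simp_all add: assms)
qed

lemma
  assumes "balanced \<beta>"
  shows tensor_lift_add: "tensor_lift \<beta> (s + t) = tensor_lift \<beta> s + tensor_lift \<beta> t"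
    and tensor_lift_tensor: "tensor_lift \<beta> (x \<otimes>\<^sub>t y) = \<beta> x y"
proof -
  have "\<exists>!h. (\<forall>s t. h (s + t) = h s + h t) \<and> (\<forall>x y. h (x \<otimes>\<^sub>t y) = \<beta> x y)"
    using tensor_lift_exists[OF assms] by (auto intro!: tensor_additive_unique)
  from theI'[OF this] show "tensor_lift \<beta> (s + t) = tensor_lift \<beta> s + tensor_lift \<beta> t"
    "tensor_lift \<beta> (x \<otimes>\<^sub>t y) = \<beta> x y"
    unfolding tensor_lift_def by blast+
qed

lemma balanced_cbilinear: "cbilinear \<beta> \<Longrightarrow> balanced \<beta>"
  by (simp add: cbilinear_def balanced_def clinear_iff)

lemma clinear_tensor_lift:
  assumes "cbilinear \<beta>"
  shows "clinear (tensor_lift \<beta>)"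
proof -
  note b = balanced_cbilinear[OF assms]
  have "tensor_lift \<beta> (c *\<^sub>C t) = c *\<^sub>C tensor_lift \<beta> t" for c t
  proof (induction t)
    case (tensor x y)
    then show ?case using assms
      by (simp add: tensor_lift_tensor[OF b] cbilinear_def clinear_iff flip: tensor_scaleC_left)
  qed (simp add: scaleC_add_right tensor_lift_add[OF b])
  then show ?thesis by (simp add: clinear_iff tensor_lift_add[OF b])
qed

definition tensor_map ::
    "('a::complex_vector \<Rightarrow> 'c::complex_vector) \<Rightarrow> ('b::complex_vector \<Rightarrow> 'd::complex_vector) \<Rightarrow>
      ('a, 'b) tensor \<Rightarrow> ('c, 'd) tensor"
  where "tensor_map f g = tensor_lift (\<lambda>x y. f x \<otimes>\<^sub>t g y)"

lemma tensor_map_tensor: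
  "clinear f \<Longrightarrow> clinear g \<Longrightarrow> tensor_map f g (x \<otimes>\<^sub>t y) = f x \<otimes>\<^sub>t g y"
  unfolding tensor_map_def
  by (rule tensor_lift_tensor) (simp add: balanced_def clinear_iff tensor_add_left tensor_add_right
      tensor_scaleC_left tensor_scaleC_right)

lemma clinear_tensor_map: "clinear f \<Longrightarrow> clinear g \<Longrightarrow> clinear (tensor_map f g)"
  unfolding tensor_map_def
  by (rule clinear_tensor_lift) (simp add: cbilinear_def clinear_iff tensor_add_left
      tensor_add_right tensor_scaleC_left tensor_scaleC_right)

lemma balanced_antilinear:
  "antilinear f \<Longrightarrow> antilinear g \<Longrightarrow> balanced (\<lambda>x y. f x \<otimes>\<^sub>t g y)"
  by (simp add: balanced_def antilinear_def tensor_add_left tensor_add_right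
      tensor_scaleC_left tensor_scaleC_right)

lemma tensor_map_tensor_antilinear:
  "antilinear f \<Longrightarrow> antilinear g \<Longrightarrow> tensor_map f g (x \<otimes>\<^sub>t y) = f x \<otimes>\<^sub>t g y"
  unfolding tensor_map_def by (rule tensor_lift_tensor) (rule balanced_antilinear)

lemma antilinear_tensor_map:
  assumes "antilinear f" "antilinear g"
  shows "antilinear (tensor_map f g)"
proof -
  note add = tensor_lift_add[OF balanced_antilinear[OF assms], folded tensor_map_def]
  have "tensor_map f g (c *\<^sub>C t) = cnj c *\<^sub>C tensor_map f g t" for c t
  proof (induction t)
    case (tensor x y)
    have "f (c *\<^sub>C x) = cnj c *\<^sub>C f x" using assms by (simp add: antilinear_def)
    have "tensor_map f g (c *\<^sub>C (x \<otimes>\<^sub>t y)) = tensor_map f g ((c *\<^sub>C x) \<otimes>\<^sub>t y)"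
      by (simp only: tensor_scaleC_left)
    also have "\<dots> = f (c *\<^sub>C x) \<otimes>\<^sub>t g y"
      by (rule tensor_map_tensor_antilinear[OF assms])
    also have "\<dots> = cnj c *\<^sub>C tensor_map f g (x \<otimes>\<^sub>t y)"
      by (simp only: tensor_map_tensor_antilinear[OF assms] \<open>f (c *\<^sub>C x) = _\<close> tensor_scaleC_left)
    finally show ?case .
  qed (simp add: add scaleC_add_right)
  then show ?thesis by (simp add: antilinear_def add)
qed

definition tensor_assoc ::
    "(('a::complex_vector, 'b::complex_vector) tensor, 'c::complex_vector) tensor \<Rightarrow>
      ('a, ('b, 'c) tensor) tensor"
  where "tensor_assoc = tensor_lift (\<lambda>s z. tensor_lift (\<lambda>x y. x \<otimes>\<^sub>t (y \<otimes>\<^sub>t z)) s)"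

lemma cbilinear_lift_left:
  assumes "\<And>z. cbilinear (\<lambda>x y. f x y z)" "\<And>x y. clinear (f x y)"
  shows "cbilinear (\<lambda>s z. tensor_lift (\<lambda>x y. f x y z) s)"
proof -
  define T where "T z = tensor_lift (\<lambda>x y. f x y z)" for z
  have T_add: "T z (s + t) = T z s + T z t" and T_tensor: "T z (x \<otimes>\<^sub>t y) = f x y z" for z s t x y
    unfolding T_def
    by (rule tensor_lift_add[OF balanced_cbilinear[OF assms(1)]],
      rule tensor_lift_tensor[OF balanced_cbilinear[OF assms(1)]])
  have T_lin: "clinear (T z)" for z
    unfolding T_def by (rule clinear_tensor_lift[OF assms(1)])
  have "T (z + z') s = T z s + T z' s" for z z' s
    using assms(2) by (induction s) (simp_all add: T_add T_tensor clinear_iff)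
  moreover have "T (c *\<^sub>C z) s = c *\<^sub>C T z s" for c z s
    using assms(2) by (induction s) (simp_all add: T_add T_tensor clinear_iff scaleC_add_right)
  ultimately have "cbilinear (\<lambda>s z. T z s)"
    using T_lin by (simp add: cbilinear_def clinear_iff)
  then show ?thesis by (simp only: T_def)
qed

lemma cbilinear_assoc:
  "cbilinear (\<lambda>s z. tensor_lift (\<lambda>x y. x \<otimes>\<^sub>t (y \<otimes>\<^sub>t z)) s)"
  by (rule cbilinear_lift_left)
    (simp_all add: cbilinear_def clinear_iff tensor_add_left tensor_add_right
      tensor_scaleC_left tensor_scaleC_right)

lemma tensor_assoc_tensor: "tensor_assoc ((x \<otimes>\<^sub>t y) \<otimes>\<^sub>t z) = x \<otimes>\<^sub>t (y \<otimes>\<^sub>t z)"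
proof -
  have "balanced (\<lambda>x y. x \<otimes>\<^sub>t (y \<otimes>\<^sub>t z))"
    by (rule balanced_cbilinear)
      (simp add: cbilinear_def clinear_iff tensor_add_left tensor_add_right
        tensor_scaleC_left tensor_scaleC_right)
  from tensor_lift_tensor[OF this] show ?thesis
    unfolding tensor_assoc_def
    by (simp add: tensor_lift_tensor[OF balanced_cbilinear[OF cbilinear_assoc]])
qed

lemma clinear_tensor_assoc: "clinear tensor_assoc"
  unfolding tensor_assoc_def by (rule clinear_tensor_lift[OF cbilinear_assoc])

text \<open>The image of \<open>B \<otimes> C\<close> in the tensor product of the ambient spaces.  Over a field the
  canonical map from \<open>B \<otimes> C\<close> is injective, so this is \<open>B \<otimes> C\<close> itself.\<close>

definition tensor_subspace ::
    "'a::complex_vector set \<Rightarrow> 'b::complex_vector set \<Rightarrow> ('a, 'b) tensor set"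
  where "tensor_subspace B C = complex_vector.span {b \<otimes>\<^sub>t c | b c. b \<in> B \<and> c \<in> C}"

section \<open>The tensor product of two algebras\<close>

lemma tensor_nonzero:
  assumes "x \<noteq> (0::'a::complex_vector)" "y \<noteq> (0::'b::complex_vector)"
  shows "x \<otimes>\<^sub>t y \<noteq> 0"
proof
  have ex: "\<exists>f. clinear f \<and> f z = (1::complex)" if "z \<noteq> 0" for z :: "'c::complex_vector"
  proof -
    have "complex_vector.independent {z}"
      using that by simp
    then obtain f where "clinear f" "\<forall>w\<in>{z}. f w = (1::complex)"
      using complex_vector.linear_independent_extend[of "{z}" "\<lambda>_. 1::complex"] by blast
    then show ?thesis by auto
  qed
  obtain f where f: "clinear f" "f x = (1::complex)" using ex[OF assms(1)] by blast
  obtain g where g: "clinear g" "g y = (1::complex)" using ex[OF assms(2)] by blast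
  have b: "cbilinear (\<lambda>x y. f x * g y)"
    using f(1) g(1) by (simp add: cbilinear_def clinear_iff algebra_simps)
  assume "x \<otimes>\<^sub>t y = 0"
  then have "tensor_lift (\<lambda>x y. f x * g y) (x \<otimes>\<^sub>t y) = 0"
    using complex_vector.linear_0[OF clinear_tensor_lift[OF b]] by simp
  then show False
    by (simp add: tensor_lift_tensor[OF balanced_cbilinear[OF b]] f(2) g(2))
qed

definition tensor_mult_pure ::
    "'a::complex_algebra_1 \<Rightarrow> 'b::complex_algebra_1 \<Rightarrow> ('a, 'b) tensor \<Rightarrow> ('a, 'b) tensor"
  where "tensor_mult_pure x y = tensor_map ((*) x) ((*) y)"

lemma clinear_mult: "clinear ((*) (x::'a::complex_algebra_1))"
  by (simp add: clinear_iff distrib_left mult_scaleC_right)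

lemma tensor_mult_pure_tensor:
  "tensor_mult_pure x y (x' \<otimes>\<^sub>t y') = (x * x') \<otimes>\<^sub>t (y * y')"
  by (simp add: tensor_mult_pure_def tensor_map_tensor clinear_mult)

lemma clinear_tensor_mult_pure: "clinear (tensor_mult_pure x y)"
  by (simp add: tensor_mult_pure_def clinear_tensor_map clinear_mult)

lemmas tensor_mult_pure_add = clinear_tensor_mult_pure[unfolded clinear_iff, THEN conjunct1, rule_format]
lemmas tensor_mult_pure_scaleC = clinear_tensor_mult_pure[unfolded clinear_iff, THEN conjunct2, rule_format]

lemma cbilinear_tensor_mult_pure: "cbilinear (\<lambda>x y. tensor_mult_pure x y t)"
proof -
  have "tensor_mult_pure (x + x') y t = tensor_mult_pure x y t + tensor_mult_pure x' y t" for x x' y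
    by (induction t) (simp_all add: tensor_mult_pure_tensor distrib_right tensor_add_left
        tensor_mult_pure_add)
  moreover have "tensor_mult_pure x (y + y') t = tensor_mult_pure x y t + tensor_mult_pure x y' t" for x y y'
    by (induction t) (simp_all add: tensor_mult_pure_tensor distrib_right tensor_add_right
        tensor_mult_pure_add)
  moreover have "tensor_mult_pure (c *\<^sub>C x) y t = c *\<^sub>C tensor_mult_pure x y t" for c x y
    by (induction t) (simp_all add: tensor_mult_pure_tensor mult_scaleC_left tensor_scaleC_left
        tensor_mult_pure_add scaleC_add_right)
  moreover have "tensor_mult_pure x (c *\<^sub>C y) t = c *\<^sub>C tensor_mult_pure x y t" for c x y
    by (induction t) (simp_all add: tensor_mult_pure_tensor mult_scaleC_left tensor_scaleC_right
        tensor_mult_pure_add scaleC_add_right)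
  ultimately show ?thesis by (simp add: cbilinear_def clinear_iff)
qed

instantiation tensor :: (complex_algebra_1, complex_algebra_1) complex_algebra_1
begin

definition one_tensor :: "('a, 'b) tensor"
  where "1 = 1 \<otimes>\<^sub>t 1"

definition times_tensor :: "('a, 'b) tensor \<Rightarrow> ('a, 'b) tensor \<Rightarrow> ('a, 'b) tensor"
  where "s * t = tensor_lift (\<lambda>x y. tensor_mult_pure x y t) s"

instance
proof
  fix r s t :: "('a, 'b) tensor" and c :: complex
  have pure: "(x \<otimes>\<^sub>t y) * t = tensor_mult_pure x y t" for x y and t :: "('a, 'b) tensor"
    unfolding times_tensor_def
    by (rule tensor_lift_tensor[OF balanced_cbilinear[OF cbilinear_tensor_mult_pure]])
  show dr: "(r + s) * t = r * t + s * t" for r s t :: "('a, 'b) tensor"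
    unfolding times_tensor_def
    by (rule tensor_lift_add[OF balanced_cbilinear[OF cbilinear_tensor_mult_pure]])
  show dl: "r * (s + t) = r * s + r * t" for r s t :: "('a, 'b) tensor"
    by (induction r) (simp_all add: pure dr tensor_mult_pure_add)
  show "c *\<^sub>C s * t = c *\<^sub>C (s * t)"
    unfolding times_tensor_def
    by (rule clinear_tensor_lift[OF cbilinear_tensor_mult_pure, unfolded clinear_iff,
          THEN conjunct2, rule_format])
  show "s * c *\<^sub>C t = c *\<^sub>C (s * t)"
    by (induction s) (simp_all add: pure dr tensor_mult_pure_scaleC scaleC_add_right)
  show "1 * t = t"
    by (induction t) (simp_all add: dl, simp add: one_tensor_def pure tensor_mult_pure_tensor)
  show "t * 1 = t"
    by (induction t) (simp_all add: dr, simp add: one_tensor_def pure tensor_mult_pure_tensor)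
  have "(x \<otimes>\<^sub>t y) * (x' \<otimes>\<^sub>t y') * t = (x \<otimes>\<^sub>t y) * ((x' \<otimes>\<^sub>t y') * t)" for x x' y y' and t :: "('a, 'b) tensor"
    by (induction t) (simp_all add: dl, simp add: pure tensor_mult_pure_tensor mult.assoc)
  then have "(x \<otimes>\<^sub>t y) * s * t = (x \<otimes>\<^sub>t y) * (s * t)" for x y
    by (induction s) (simp_all add: dl dr)
  then show "r * s * t = r * (s * t)"
    by (induction r) (simp_all add: dr)
  show "(0 :: ('a, 'b) tensor) \<noteq> 1"
    unfolding one_tensor_def using tensor_nonzero[of "1::'a" "1::'b"] by simp
qed

end

lemma tensor_mult_tensor: "(x \<otimes>\<^sub>t y) * (x' \<otimes>\<^sub>t y') = (x * x') \<otimes>\<^sub>t (y * y')"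
  unfolding times_tensor_def
  by (subst tensor_lift_tensor[OF balanced_cbilinear[OF cbilinear_tensor_mult_pure]])
    (rule tensor_mult_pure_tensor)

section \<open>Real quantum groups\<close>

locale coalgebra =
  fixes \<Delta> :: "'c::complex_vector \<Rightarrow> ('c, 'c) tensor"
    and \<epsilon> :: "'c \<Rightarrow> complex"
  assumes linear_comult: "clinear \<Delta>"
    and linear_counit: "clinear \<epsilon>"
    and coassoc: "tensor_assoc (tensor_map \<Delta> id (\<Delta> x)) = tensor_map id \<Delta> (\<Delta> x)"
    and counit_left: "tensor_lift (\<lambda>c x. c *\<^sub>C x) (tensor_map \<epsilon> id (\<Delta> x)) = x"
    and counit_right: "tensor_lift (\<lambda>x c. c *\<^sub>C x) (tensor_map id \<epsilon> (\<Delta> x)) = x"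

locale hopf_algebra = coalgebra \<Delta> \<epsilon>
  for \<Delta> :: "'a::complex_algebra_1 \<Rightarrow> ('a, 'a) tensor" and \<epsilon> :: "'a \<Rightarrow> complex" +
  fixes S :: "'a \<Rightarrow> 'a"
  assumes comult_mult: "\<Delta> (x * y) = \<Delta> x * \<Delta> y"
    and comult_one: "\<Delta> 1 = 1"
    and counit_mult: "\<epsilon> (x * y) = \<epsilon> x * \<epsilon> y"
    and counit_one: "\<epsilon> 1 = 1"
    and linear_antipode: "clinear S"
    and antipode_left: "tensor_lift (*) (tensor_map S id (\<Delta> x)) = \<epsilon> x *\<^sub>C 1"
    and antipode_right: "tensor_lift (*) (tensor_map id S (\<Delta> x)) = \<epsilon> x *\<^sub>C 1"

locale star_algebra =
  fixes star :: "'a::complex_algebra_1 \<Rightarrow> 'a"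
  assumes antilinear_star: "antilinear star"
    and star_mult: "star (x * y) = star y * star x"
    and star_star: "star (star x) = x"

definition hopf_tau :: "('a \<Rightarrow> 'a) \<Rightarrow> ('a \<Rightarrow> 'a) \<Rightarrow> 'a \<Rightarrow> 'a"
  where "hopf_tau S star = star \<circ> S"

locale real_quantum_group = hopf_algebra \<Delta> \<epsilon> S + star_algebra star
  for \<Delta> :: "'a::complex_algebra_1 \<Rightarrow> ('a, 'a) tensor" and \<epsilon> :: "'a \<Rightarrow> complex"
    and S :: "'a \<Rightarrow> 'a" and star :: "'a \<Rightarrow> 'a" +
  assumes comult_star: "\<Delta> (star x) = tensor_map star star (\<Delta> x)"
    and counit_star: "\<epsilon> (star x) = cnj (\<epsilon> x)"
    and tau_involutive: "hopf_tau S star \<circ> hopf_tau S star = id"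

section \<open>Real coisotropic quantum subgroups\<close>

locale coalgebra_morphism = source: coalgebra \<Delta> \<epsilon> + target: coalgebra \<Delta>' \<epsilon>'
  for \<Delta> :: "'c::complex_vector \<Rightarrow> ('c, 'c) tensor" and \<epsilon> :: "'c \<Rightarrow> complex"
    and \<Delta>' :: "'d::complex_vector \<Rightarrow> ('d, 'd) tensor" and \<epsilon>' :: "'d \<Rightarrow> complex" +
  fixes \<pi> :: "'c \<Rightarrow> 'd"
  assumes linear_morphism: "clinear \<pi>"
    and comult_morphism: "\<Delta>' (\<pi> x) = tensor_map \<pi> \<pi> (\<Delta> x)"
    and counit_morphism: "\<epsilon>' (\<pi> x) = \<epsilon> x"

locale left_module_action =
  fixes act :: "'a::complex_algebra_1 \<Rightarrow> 'k::complex_vector \<Rightarrow> 'k"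
  assumes bilinear_act: "cbilinear act"
    and act_one: "act 1 k = k"
    and act_mult: "act (a * b) k = act a (act b k)"

locale right_module_action =
  fixes act :: "'k::complex_vector \<Rightarrow> 'a::complex_algebra_1 \<Rightarrow> 'k"
  assumes bilinear_act: "cbilinear act"
    and act_one: "act k 1 = k"
    and act_mult: "act k (a * b) = act (act k a) b"

locale real_coisotropic_left_subgroup =
  real_quantum_group \<Delta> \<epsilon> S star + coalgebra_morphism \<Delta> \<epsilon> \<Delta>\<^sub>K \<epsilon>\<^sub>K \<pi> + left_module_action act
  for \<Delta> :: "'a::complex_algebra_1 \<Rightarrow> ('a, 'a) tensor" and \<epsilon> :: "'a \<Rightarrow> complex"
    and S :: "'a \<Rightarrow> 'a" and star :: "'a \<Rightarrow> 'a"
    and \<Delta>\<^sub>K :: "'k::complex_vector \<Rightarrow> ('k, 'k) tensor" and \<epsilon>\<^sub>K :: "'k \<Rightarrow> complex"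
    and act :: "'a \<Rightarrow> 'k \<Rightarrow> 'k" and \<pi> :: "'a \<Rightarrow> 'k" +
  fixes \<tau>\<^sub>K :: "'k \<Rightarrow> 'k"
  assumes surj_projection: "surj \<pi>"
    and projection_act: "\<pi> (a * b) = act a (\<pi> b)"
    and antilinear_tau: "antilinear \<tau>\<^sub>K"
    and tau_projection: "\<tau>\<^sub>K \<circ> \<pi> = \<pi> \<circ> hopf_tau S star"

locale real_coisotropic_right_subgroup =
  real_quantum_group \<Delta> \<epsilon> S star + coalgebra_morphism \<Delta> \<epsilon> \<Delta>\<^sub>K \<epsilon>\<^sub>K \<pi> + right_module_action act
  for \<Delta> :: "'a::complex_algebra_1 \<Rightarrow> ('a, 'a) tensor" and \<epsilon> :: "'a \<Rightarrow> complex"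
    and S :: "'a \<Rightarrow> 'a" and star :: "'a \<Rightarrow> 'a"
    and \<Delta>\<^sub>K :: "'k::complex_vector \<Rightarrow> ('k, 'k) tensor" and \<epsilon>\<^sub>K :: "'k \<Rightarrow> complex"
    and act :: "'k \<Rightarrow> 'a \<Rightarrow> 'k" and \<pi> :: "'a \<Rightarrow> 'k" +
  fixes \<tau>\<^sub>K :: "'k \<Rightarrow> 'k"
  assumes surj_projection: "surj \<pi>"
    and projection_act: "\<pi> (a * b) = act (\<pi> a) b"
    and antilinear_tau: "antilinear \<tau>\<^sub>K"
    and tau_projection: "\<tau>\<^sub>K \<circ> \<pi> = \<pi> \<circ> hopf_tau S star"

section \<open>Embeddable quantum homogeneous spaces\<close>

definition star_subalgebra :: "('a::complex_algebra_1 \<Rightarrow> 'a) \<Rightarrow> 'a set \<Rightarrow> bool"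
  where "star_subalgebra star B \<longleftrightarrow>
    complex_vector.subspace B \<and> 1 \<in> B \<and> (\<forall>x\<in>B. \<forall>y\<in>B. x * y \<in> B) \<and> (\<forall>x\<in>B. star x \<in> B)"

definition right_coideal :: "('a::complex_vector \<Rightarrow> ('a, 'a) tensor) \<Rightarrow> 'a set \<Rightarrow> bool"
  where "right_coideal \<Delta> B \<longleftrightarrow>
    complex_vector.subspace B \<and> \<Delta> ` B \<subseteq> tensor_subspace B UNIV"

definition left_coideal :: "('a::complex_vector \<Rightarrow> ('a, 'a) tensor) \<Rightarrow> 'a set \<Rightarrow> bool"
  where "left_coideal \<Delta> B \<longleftrightarrow>
    complex_vector.subspace B \<and> \<Delta> ` B \<subseteq> tensor_subspace UNIV B"

text \<open>The \<open>*\<close>-algebra \<open>B\<close> below is a \<open>*\<close>-subalgebra of an ambient \<open>*\<close>-algebra \<open>'b\<close> (possibly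
  \<open>UNIV\<close>).  The coaction and the embedding are linear maps on \<open>'b\<close> of which only the restrictions
  to \<open>B\<close> matter; every linear map on \<open>B\<close> has such an extension.\<close>

definition right_coaction_on ::
    "('a::complex_vector \<Rightarrow> ('a, 'a) tensor) \<Rightarrow> ('a \<Rightarrow> complex) \<Rightarrow>
      'b::complex_vector set \<Rightarrow> ('b \<Rightarrow> ('b, 'a) tensor) \<Rightarrow> bool"
  where "right_coaction_on \<Delta> \<epsilon> B \<delta> \<longleftrightarrow>
    clinear \<delta> \<and> \<delta> ` B \<subseteq> tensor_subspace B UNIV \<and>
    (\<forall>b\<in>B. tensor_assoc (tensor_map \<delta> id (\<delta> b)) = tensor_map id \<Delta> (\<delta> b)) \<and>
    (\<forall>b\<in>B. tensor_lift (\<lambda>x c. c *\<^sub>C x) (tensor_map id \<epsilon> (\<delta> b)) = b)"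

definition left_coaction_on ::
    "('a::complex_vector \<Rightarrow> ('a, 'a) tensor) \<Rightarrow> ('a \<Rightarrow> complex) \<Rightarrow>
      'b::complex_vector set \<Rightarrow> ('b \<Rightarrow> ('a, 'b) tensor) \<Rightarrow> bool"
  where "left_coaction_on \<Delta> \<epsilon> B \<delta> \<longleftrightarrow>
    clinear \<delta> \<and> \<delta> ` B \<subseteq> tensor_subspace UNIV B \<and>
    (\<forall>b\<in>B. tensor_map id \<delta> (\<delta> b) = tensor_assoc (tensor_map \<Delta> id (\<delta> b))) \<and>
    (\<forall>b\<in>B. tensor_lift (\<lambda>c x. c *\<^sub>C x) (tensor_map \<epsilon> id (\<delta> b)) = b)"

definition star_embedding_on ::
    "('b::complex_algebra_1 \<Rightarrow> 'b) \<Rightarrow> ('a::complex_algebra_1 \<Rightarrow> 'a) \<Rightarrow> 'b set \<Rightarrow> ('b \<Rightarrow> 'a) \<Rightarrow> bool"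
  where "star_embedding_on star\<^sub>B star B i \<longleftrightarrow>
    clinear i \<and> inj_on i B \<and> i 1 = 1 \<and>
    (\<forall>x\<in>B. \<forall>y\<in>B. i (x * y) = i x * i y) \<and> (\<forall>x\<in>B. i (star\<^sub>B x) = star (i x))"

text \<open>Left homogeneous spaces carry right coactions, and conversely.\<close>

definition left_embeddable_homogeneous_space ::
    "('a::complex_algebra_1 \<Rightarrow> ('a, 'a) tensor) \<Rightarrow> ('a \<Rightarrow> complex) \<Rightarrow> ('a \<Rightarrow> 'a) \<Rightarrow>
      ('b::complex_algebra_1 \<Rightarrow> 'b) \<Rightarrow> 'b set \<Rightarrow> ('b \<Rightarrow> ('b, 'a) tensor) \<Rightarrow> ('b \<Rightarrow> 'a) \<Rightarrow> bool"
  where "left_embeddable_homogeneous_space \<Delta> \<epsilon> star star\<^sub>B B \<delta> i \<longleftrightarrow>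
    star_algebra star\<^sub>B \<and> star_subalgebra star\<^sub>B B \<and>
    right_coaction_on \<Delta> \<epsilon> B \<delta> \<and> star_embedding_on star\<^sub>B star B i \<and>
    (\<forall>b\<in>B. \<Delta> (i b) = tensor_map i id (\<delta> b))"

definition right_embeddable_homogeneous_space ::
    "('a::complex_algebra_1 \<Rightarrow> ('a, 'a) tensor) \<Rightarrow> ('a \<Rightarrow> complex) \<Rightarrow> ('a \<Rightarrow> 'a) \<Rightarrow>
      ('b::complex_algebra_1 \<Rightarrow> 'b) \<Rightarrow> 'b set \<Rightarrow> ('b \<Rightarrow> ('a, 'b) tensor) \<Rightarrow> ('b \<Rightarrow> 'a) \<Rightarrow> bool"
  where "right_embeddable_homogeneous_space \<Delta> \<epsilon> star star\<^sub>B B \<delta> i \<longleftrightarrow>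
    star_algebra star\<^sub>B \<and> star_subalgebra star\<^sub>B B \<and>
    left_coaction_on \<Delta> \<epsilon> B \<delta> \<and> star_embedding_on star\<^sub>B star B i \<and>
    (\<forall>b\<in>B. \<Delta> (i b) = tensor_map id i (\<delta> b))"

definition B_sub :: "('a::complex_algebra_1 \<Rightarrow> ('a, 'a) tensor) \<Rightarrow> ('a \<Rightarrow> 'k::complex_vector) \<Rightarrow> 'a set"
  where "B_sub \<Delta> \<pi> = {a. tensor_map \<pi> id (\<Delta> a) = \<pi> 1 \<otimes>\<^sub>t a}"

definition B_sup :: "('a::complex_algebra_1 \<Rightarrow> ('a, 'a) tensor) \<Rightarrow> ('a \<Rightarrow> 'k::complex_vector) \<Rightarrow> 'a set"
  where "B_sup \<Delta> \<pi> = {a. tensor_map id \<pi> (\<Delta> a) = a \<otimes>\<^sub>t \<pi> 1}"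

end

theory Submission
  imports Defs
begin

text \<open>All conditions but two are direct.  If \<open>B\<close> is the kernel of a linear map \<open>f\<close> and \<open>(f \<otimes> id) \<Delta>\<close>
  vanishes on \<open>B\<close>, then \<open>B\<close> is a right coideal of the Hopf algebra \<open>A\<close>, because over a field the kernel of \<open>f \<otimes> id\<close> is
  \<open>ker f \<otimes> A\<close>; coassociativity supplies the vanishing.  For the stability under \<open>*\<close>, put
  \<open>\<sigma> = * \<circ> S \<circ> *\<close>.  Applying \<open>*\<close> to the antipode axioms gives \<open>\<sigma>(a\<^sub>2) a\<^sub>1 = \<epsilon>(a) = a\<^sub>2 \<sigma>(a\<^sub>1)\<close>, and
  \<open>\<tau>\<^sup>2 = id\<close> gives \<open>\<pi>(a\<^sup>*) = \<tau>\<^sub>K(\<pi>(\<sigma>(a)))\<close>.  If \<open>\<pi>(a\<^sub>1) \<otimes> a\<^sub>2 = \<pi>(1) \<otimes> a\<close>, then comultiplying the second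
  factor and letting \<open>\<sigma>\<close> of the middle one act on the first turns this into
  \<open>\<pi>(1) \<otimes> a = \<pi>(\<sigma>(a\<^sub>1)) \<otimes> a\<^sub>2\<close>, to which \<open>\<tau>\<^sub>K \<otimes> *\<close> is applied.
  Right subgroups are treated by the mirror image of this argument.\<close>

section \<open>Linear maps on tensor products\<close>

lemma clinear_add: "clinear f \<Longrightarrow> f (x + y) = f x + f y"
  and clinear_scaleC: "clinear f \<Longrightarrow> f (c *\<^sub>C x) = c *\<^sub>C f x"
  by (simp_all add: clinear_iff)

lemma clinear_id: "clinear id"
  by (simp add: clinear_iff)

lemma clinear_ident [simp]: "clinear (\<lambda>x. x)"
  by (simp add: clinear_iff)

lemma clinear_plus: "clinear f \<Longrightarrow> clinear g \<Longrightarrow> clinear (\<lambda>x. f x + g x)"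
  by (simp add: clinear_iff scaleC_add_right)

lemma clinear_scale: "clinear f \<Longrightarrow> clinear (\<lambda>x. c *\<^sub>C f x)"
  by (simp add: clinear_iff scaleC_add_right scaleC_scaleC mult.commute)

lemma clinear_compose: "clinear f \<Longrightarrow> clinear g \<Longrightarrow> clinear (\<lambda>x. g (f x))"
  by (simp add: clinear_iff)

lemma clinear_diff: "clinear f \<Longrightarrow> clinear g \<Longrightarrow> clinear (\<lambda>x. f x - g x)"
  by (simp add: clinear_iff complex_vector.scale_right_diff_distrib)

lemma clinear_tensor_left: "clinear (\<lambda>x. x \<otimes>\<^sub>t y)"
  and clinear_tensor_right: "clinear (\<lambda>y. x \<otimes>\<^sub>t y)"
  by (simp_all add: clinear_iff tensor_add_left tensor_add_right tensor_scaleC_left tensor_scaleC_right)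

lemma cbilinear_scaleC: "cbilinear (\<lambda>c x. c *\<^sub>C x)"
  by (simp add: cbilinear_def clinear_iff scaleC_add_left scaleC_add_right scaleC_scaleC mult.commute)

lemma cbilinear_scaleC_flip: "cbilinear (\<lambda>x c. c *\<^sub>C x)"
  using cbilinear_scaleC by (auto simp: cbilinear_def)

lemma cbilinear_mult: "cbilinear ((*) :: 'a::complex_algebra_1 \<Rightarrow> 'a \<Rightarrow> 'a)"
  by (simp add: cbilinear_def clinear_iff algebra_simps mult_scaleC_left mult_scaleC_right)

lemma cbilinear_compose:
  assumes "cbilinear \<beta>" "clinear f" "clinear g" "clinear h"
  shows "cbilinear (\<lambda>x y. h (\<beta> (f x) (g y)))"
  using assms by (simp add: cbilinear_def clinear_iff)

lemma cbilinear_flip: "cbilinear \<beta> \<Longrightarrow> cbilinear (\<lambda>x y. \<beta> y x)"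
  by (simp add: cbilinear_def)

lemma clinear_cbilinear_left: "cbilinear \<beta> \<Longrightarrow> clinear (\<lambda>x. \<beta> x y)"
  and clinear_cbilinear_right: "cbilinear \<beta> \<Longrightarrow> clinear (\<beta> x)"
  by (simp_all add: cbilinear_def)

section \<open>Calculus of maps on tensor products\<close>

lemma tensor_lift_cbilinear: "cbilinear \<beta> \<Longrightarrow> tensor_lift \<beta> (x \<otimes>\<^sub>t y) = \<beta> x y"
  by (rule tensor_lift_tensor[OF balanced_cbilinear])

lemma tensor_map_add: "clinear f \<Longrightarrow> clinear g \<Longrightarrow> tensor_map f g (s + t) = tensor_map f g s + tensor_map f g t"
  by (rule clinear_add[OF clinear_tensor_map])

lemma tensor_map_add_antilinear:
  "antilinear f \<Longrightarrow> antilinear g \<Longrightarrow> tensor_map f g (s + t) = tensor_map f g s + tensor_map f g t"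
  using antilinear_tensor_map[of f g] by (simp add: antilinear_def)

text \<open>Pure tensors generate the tensor product additively. Identities that Sweedler notation
  would leave implicit are checked on them.\<close>

lemma tensor_clinear_eqI:
  assumes "clinear h" "clinear k" "\<And>x y. h (x \<otimes>\<^sub>t y) = k (x \<otimes>\<^sub>t y)"
  shows "h t = k t"
  using tensor_additive_unique[of h k] assms by (simp add: clinear_iff)

lemma tensor_map_id: "tensor_map id id t = t"
  by (rule tensor_clinear_eqI[where k = "\<lambda>t. t"])
    (simp_all add: clinear_tensor_map clinear_id[unfolded id_def] tensor_map_tensor id_def)

lemma tensor_map_compose:
  assumes "clinear f" "clinear g" "clinear f'" "clinear g'"
  shows "tensor_map f' g' (tensor_map f g t) = tensor_map (\<lambda>x. f' (f x)) (\<lambda>y. g' (g y)) t"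
  by (rule tensor_clinear_eqI[where h = "\<lambda>t. tensor_map f' g' (tensor_map f g t)"])
    (simp_all add: assms clinear_compose[of "tensor_map f g"] clinear_tensor_map clinear_compose
      tensor_map_tensor)

lemma tensor_map_diff_left:
  assumes "clinear f" "clinear g" "clinear h"
  shows "tensor_map (\<lambda>x. f x - g x) h t = tensor_map f h t - tensor_map g h t"
proof (induction t)
  case (tensor x y)
  show ?case
    using complex_vector.linear_diff[OF clinear_tensor_left[of "h y"], of "f x" "g x"]
    by (simp add: tensor_map_tensor assms clinear_diff)
qed (simp add: tensor_map_add assms clinear_diff)

lemma tensor_map_diff_right:
  assumes "clinear f" "clinear g" "clinear h"
  shows "tensor_map h (\<lambda>x. f x - g x) t = tensor_map h f t - tensor_map h g t"
proof (induction t)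
  case (tensor y x)
  show ?case
    using complex_vector.linear_diff[OF clinear_tensor_right[of "h y"], of "f x" "g x"]
    by (simp add: tensor_map_tensor assms clinear_diff)
qed (simp add: tensor_map_add assms clinear_diff)

lemma tensor_lift_tensor_map:
  assumes "cbilinear \<beta>" "clinear f" "clinear g"
  shows "tensor_lift \<beta> (tensor_map f g t) = tensor_lift (\<lambda>x y. \<beta> (f x) (g y)) t"
proof (rule tensor_clinear_eqI[where h = "\<lambda>t. tensor_lift \<beta> (tensor_map f g t)"])
  have *: "cbilinear (\<lambda>x y. \<beta> (f x) (g y))"
    by (rule cbilinear_compose[OF assms clinear_id, simplified])
  show "clinear (\<lambda>t. tensor_lift \<beta> (tensor_map f g t))"
    by (rule clinear_compose[OF clinear_tensor_map[OF assms(2,3)] clinear_tensor_lift[OF assms(1)]])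
  show "clinear (tensor_lift (\<lambda>x y. \<beta> (f x) (g y)))"
    by (rule clinear_tensor_lift[OF *])
  show "tensor_lift \<beta> (tensor_map f g (x \<otimes>\<^sub>t y)) = tensor_lift (\<lambda>x y. \<beta> (f x) (g y)) (x \<otimes>\<^sub>t y)" for x y
    by (simp add: tensor_map_tensor assms tensor_lift_cbilinear *)
qed

text \<open>Moves a linear map inside a contraction; later this brings the projection \<pi> next to
  a product, where its module property applies.\<close>

lemma clinear_tensor_lift_comp:
  assumes "cbilinear \<beta>" "clinear h"
  shows "h (tensor_lift \<beta> t) = tensor_lift (\<lambda>x y. h (\<beta> x y)) t"
proof (rule tensor_clinear_eqI[where h = "\<lambda>t. h (tensor_lift \<beta> t)"])
  have *: "cbilinear (\<lambda>x y. h (\<beta> x y))"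
    using cbilinear_compose[OF assms(1) clinear_id clinear_id assms(2)] by simp
  show "clinear (\<lambda>t. h (tensor_lift \<beta> t))"
    by (rule clinear_compose[OF clinear_tensor_lift[OF assms(1)] assms(2)])
  show "clinear (tensor_lift (\<lambda>x y. h (\<beta> x y)))"
    by (rule clinear_tensor_lift[OF *])
  show "h (tensor_lift \<beta> (x \<otimes>\<^sub>t y)) = tensor_lift (\<lambda>x y. h (\<beta> x y)) (x \<otimes>\<^sub>t y)" for x y
    by (simp add: assms tensor_lift_cbilinear *)
qed

section \<open>Reassociation of threefold tensor products\<close>

lemma tensor_assoc_natural:
  assumes "clinear f" "clinear g" "clinear h"
  shows "tensor_assoc (tensor_map (tensor_map f g) h t) = tensor_map f (tensor_map g h) (tensor_assoc t)"
proof (induction t)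
  case (tensor s z)
  show ?case
    by (induction s) (simp_all add: assms tensor_map_tensor clinear_tensor_map tensor_assoc_tensor
        tensor_add_left tensor_map_add clinear_add[OF clinear_tensor_assoc])
qed (simp add: assms tensor_map_add clinear_tensor_map clinear_add[OF clinear_tensor_assoc])

text \<open>The inverse reassociation, written in curried form: for fixed \<open>x\<close> it
  tensors \<open>x\<close> onto the first factor of the inner tensor. It serves to cancel
  \<open>tensor_assoc\<close> in equations.\<close>

definition tensor_unassoc ::
    "('a::complex_vector, ('b::complex_vector, 'c::complex_vector) tensor) tensor \<Rightarrow>
      (('a, 'b) tensor, 'c) tensor"
  where "tensor_unassoc = tensor_lift (\<lambda>x. tensor_map (\<lambda>y. x \<otimes>\<^sub>t y) id)"

lemma cbilinear_unassoc:
  "cbilinear (\<lambda>x::'a::complex_vector.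
    tensor_map (\<lambda>y::'b::complex_vector. x \<otimes>\<^sub>t y) (id :: 'c::complex_vector \<Rightarrow> 'c))"
proof -
  have "tensor_map (\<lambda>y. (x + x') \<otimes>\<^sub>t y) id t
      = tensor_map (\<lambda>y. x \<otimes>\<^sub>t y) id t + tensor_map (\<lambda>y. x' \<otimes>\<^sub>t y) id t" for x x' :: 'a and t :: "('b, 'c) tensor"
    by (induction t) (simp_all add: tensor_map_tensor clinear_tensor_right clinear_id
        tensor_add_left tensor_map_add clinear_plus)
  moreover have "tensor_map (\<lambda>y. (c *\<^sub>C x) \<otimes>\<^sub>t y) id t = c *\<^sub>C tensor_map (\<lambda>y. x \<otimes>\<^sub>t y) id t"
    for c and x :: 'a and t :: "('b, 'c) tensor"
    by (induction t) (simp_all add: tensor_map_tensor clinear_tensor_right clinear_id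
        tensor_scaleC_left tensor_map_add scaleC_add_right clinear_scale)
  ultimately have "clinear (\<lambda>x::'a. tensor_map (\<lambda>y. x \<otimes>\<^sub>t y) id t)" for t :: "('b, 'c) tensor"
    by (simp add: clinear_iff)
  then show ?thesis
    by (simp add: cbilinear_def clinear_tensor_map clinear_tensor_right clinear_id)
qed

lemma tensor_unassoc_assoc: "tensor_unassoc (tensor_assoc t) = t"
proof (induction t)
  case (tensor s z)
  show ?case
    by (induction s) (simp_all add: tensor_assoc_tensor tensor_unassoc_def tensor_add_left
        tensor_lift_cbilinear[OF cbilinear_unassoc] tensor_map_tensor clinear_tensor_right clinear_id
        clinear_add[OF clinear_tensor_assoc] clinear_add[OF clinear_tensor_lift[OF cbilinear_unassoc]])
qed (simp add: tensor_unassoc_def clinear_add[OF clinear_tensor_assoc]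
      clinear_add[OF clinear_tensor_lift[OF cbilinear_unassoc]])

lemma tensor_assoc_inject: "tensor_assoc s = tensor_assoc t \<longleftrightarrow> s = t"
  by (metis tensor_unassoc_assoc)

text \<open>Puts a fixed left factor into the bracketing in which coassociativity is stated.\<close>

lemma tensor_assoc_map_tensor:
  "tensor_assoc (tensor_map (\<lambda>x. k \<otimes>\<^sub>t x) id t) = k \<otimes>\<^sub>t t"
  by (induction t) (simp_all add: tensor_map_tensor clinear_tensor_right clinear_id
      tensor_assoc_tensor tensor_add_right tensor_map_add clinear_add[OF clinear_tensor_assoc])

lemma tensor_assoc_tensor_right:
  "tensor_assoc (t \<otimes>\<^sub>t k) = tensor_map id (\<lambda>x. x \<otimes>\<^sub>t k) t"
  by (induction t) (simp_all add: tensor_map_tensor clinear_tensor_left clinear_id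
      tensor_assoc_tensor tensor_add_left tensor_map_add clinear_add[OF clinear_tensor_assoc])

text \<open>If \<open>g\<close> is a linear generalized inverse of \<open>f\<close>, then \<open>id - g \<circ> f\<close> is a projection onto the kernel
  of \<open>f\<close>.\<close>

lemma kernel_projection_exists:
  fixes f :: "'a::complex_vector \<Rightarrow> 'b::complex_vector"
  assumes "clinear f"
  obtains g where "clinear g" "\<And>x. f (x - g (f x)) = 0"
proof -
  \<comment> \<open>A linear splitting of \<open>f\<close> over its range exists by choosing bases;
    this is where working over a field enters.\<close>
  obtain g where g: "clinear g" "\<forall>v\<in>f ` UNIV. f (g v) = v"
    using complex_vector.linear_exists_right_inverse_on[OF assms complex_vector.subspace_UNIV] by blast
  then have "f (x - g (f x)) = 0" for x
    by (simp add: complex_vector.linear_diff[OF assms])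
  with g(1) show ?thesis by (rule that)
qed

section \<open>Kernels of tensor products with an identity map\<close>

lemma tensor_map_in_tensor_subspace:
  assumes "clinear p" "clinear q" "range p \<subseteq> B" "range q \<subseteq> C"
  shows "tensor_map p q t \<in> tensor_subspace B C"
  unfolding tensor_subspace_def
proof (induction t)
  case (tensor x y)
  show ?case
    unfolding tensor_map_tensor[OF assms(1,2)]
    using assms(3,4) by (intro complex_vector.span_base) blast
qed (simp add: assms tensor_map_add complex_vector.span_add)

text \<open>Let \<open>p = id - g \<circ> f\<close> project onto the kernel of \<open>f\<close>.
  Since \<open>f \<otimes> id\<close> kills \<open>t\<close>, the map \<open>p \<otimes> id\<close>
  fixes \<open>t\<close>, and its image lies in the tensor product of that kernel with the whole
  space.\<close>

lemma tensor_kernel_left: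
  assumes f: "clinear f" and t: "tensor_map f id t = 0"
  shows "t \<in> tensor_subspace {x. f x = 0} UNIV"
proof -
  obtain g where g: "clinear g" "\<And>x. f (x - g (f x)) = 0"
    by (rule kernel_projection_exists[OF f]) blast
  have "tensor_map (\<lambda>x. x - g (f x)) id t = t - tensor_map g id (tensor_map f id t)"
    using tensor_map_diff_left[OF clinear_id clinear_compose[OF f g(1)] clinear_id, of t]
    by (simp add: tensor_map_compose f g clinear_id tensor_map_id[unfolded id_def] id_def)
  also have "\<dots> = t"
    by (simp add: t complex_vector.linear_0[OF clinear_tensor_map[OF g(1) clinear_id]])
  finally show ?thesis
    using tensor_map_in_tensor_subspace[of "\<lambda>x. x - g (f x)" id "{x. f x = 0}" UNIV t] g
      clinear_diff[OF clinear_id clinear_compose[OF f g(1)]] by (auto simp: clinear_id)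
qed

lemma tensor_kernel_right:
  assumes f: "clinear f" and t: "tensor_map id f t = 0"
  shows "t \<in> tensor_subspace UNIV {x. f x = 0}"
proof -
  obtain g where g: "clinear g" "\<And>x. f (x - g (f x)) = 0"
    by (rule kernel_projection_exists[OF f]) blast
  have "tensor_map id (\<lambda>x. x - g (f x)) t = t - tensor_map id g (tensor_map id f t)"
    using tensor_map_diff_right[OF clinear_id clinear_compose[OF f g(1)] clinear_id, of t]
    by (simp add: tensor_map_compose f g clinear_id tensor_map_id[unfolded id_def] id_def)
  also have "\<dots> = t"
    by (simp add: t complex_vector.linear_0[OF clinear_tensor_map[OF clinear_id g(1)]])
  finally show ?thesis
    using tensor_map_in_tensor_subspace[of id "\<lambda>x. x - g (f x)" UNIV "{x. f x = 0}" t] g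
      clinear_diff[OF clinear_id clinear_compose[OF f g(1)]] by (auto simp: clinear_id)
qed

section \<open>The twisted antipode\<close>

text \<open>When \<tau> is an involution, this is the inverse of the antipode. Written through the
  star, its identities follow by conjugating the antipode axioms.\<close>

definition twisted_antipode :: "('a \<Rightarrow> 'a) \<Rightarrow> ('a \<Rightarrow> 'a) \<Rightarrow> 'a \<Rightarrow> 'a"
  where "twisted_antipode S star x = star (S (star x))"

context real_quantum_group
begin

abbreviation "\<sigma> \<equiv> twisted_antipode S star"

lemma star_add: "star (x + y) = star x + star y"
  and star_scaleC: "star (c *\<^sub>C x) = cnj c *\<^sub>C star x"
  using antilinear_star by (simp_all add: antilinear_def)

lemma star_one: "star 1 = 1"
  by (metis mult_1 mult_1_right star_mult star_star)

lemma antipode_one: "S 1 = 1"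
  using antipode_left[of 1]
  by (simp add: comult_one one_tensor_def tensor_map_tensor linear_antipode clinear_id
      tensor_lift_cbilinear[OF cbilinear_mult] counit_one)

text \<open>Ensures that \<open>\<tau>\<^sub>K\<close> fixes \<open>\<pi> 1\<close>, so that
  applying it to the coinvariance equation keeps the equation's shape.\<close>

lemma tau_one: "hopf_tau S star 1 = 1"
  by (simp add: hopf_tau_def antipode_one star_one)

lemma clinear_twisted_antipode: "clinear \<sigma>"
  by (simp add: clinear_iff twisted_antipode_def star_add star_scaleC
      clinear_add[OF linear_antipode] clinear_scaleC[OF linear_antipode])

lemma star_twisted_antipode: "star (\<sigma> x) = S (star x)"
  by (simp add: twisted_antipode_def star_star)

text \<open>Unfolded, the left side is \<tau> applied twice to \<open>star x\<close>; here the
  involutivity of \<tau> enters.\<close>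

lemma tau_star: "hopf_tau S star (\<sigma> x) = star x"
  using fun_cong[OF tau_involutive, of "star x"] by (simp add: hopf_tau_def twisted_antipode_def)

text \<open>In Sweedler notation, \<sigma>(a_2) a_1 = \<epsilon>(a). The star reverses the product
  to star(a_1) S(star(a_2)), which is the right antipode axiom for \<open>star a\<close> because
  \<Delta> commutes with the star.\<close>

lemma twisted_antipode_left:
  "tensor_lift (\<lambda>x y. \<sigma> y * x) (\<Delta> a) = \<epsilon> a *\<^sub>C 1"
proof -
  have b: "cbilinear (\<lambda>x y. \<sigma> y * x)"
    by (rule cbilinear_compose[OF cbilinear_flip[OF cbilinear_mult] clinear_id
          clinear_twisted_antipode clinear_id, simplified])
  have "star (tensor_lift (\<lambda>x y. \<sigma> y * x) t)
      = tensor_lift (*) (tensor_map id S (tensor_map star star t))" for t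
    by (induction t) (simp_all add: tensor_lift_cbilinear[OF b] tensor_lift_cbilinear[OF cbilinear_mult]
        tensor_map_tensor tensor_map_tensor_antilinear antilinear_star clinear_id linear_antipode
        star_mult star_twisted_antipode star_add tensor_map_add tensor_map_add_antilinear
        clinear_add[OF clinear_tensor_lift[OF b]] clinear_add[OF clinear_tensor_lift[OF cbilinear_mult]])
  from this[of "\<Delta> a"] have "star (tensor_lift (\<lambda>x y. \<sigma> y * x) (\<Delta> a)) = cnj (\<epsilon> a) *\<^sub>C 1"
    by (simp add: antipode_right counit_star flip: comult_star)
  then show ?thesis
    by (metis star_star star_scaleC star_one complex_cnj_cnj)
qed

text \<open>In Sweedler notation, a_2 \<sigma>(a_1) = \<epsilon>(a), obtained in the same way from
  the left antipode axiom.\<close>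

lemma twisted_antipode_right:
  "tensor_lift (\<lambda>x y. y * \<sigma> x) (\<Delta> a) = \<epsilon> a *\<^sub>C 1"
proof -
  have b: "cbilinear (\<lambda>x y. y * \<sigma> x)"
    by (rule cbilinear_compose[OF cbilinear_flip[OF cbilinear_mult]
          clinear_twisted_antipode clinear_id clinear_id, simplified])
  have "star (tensor_lift (\<lambda>x y. y * \<sigma> x) t)
      = tensor_lift (*) (tensor_map S id (tensor_map star star t))" for t
    by (induction t) (simp_all add: tensor_lift_cbilinear[OF b] tensor_lift_cbilinear[OF cbilinear_mult]
        tensor_map_tensor tensor_map_tensor_antilinear antilinear_star clinear_id linear_antipode
        star_mult star_twisted_antipode star_add tensor_map_add tensor_map_add_antilinear
        clinear_add[OF clinear_tensor_lift[OF b]] clinear_add[OF clinear_tensor_lift[OF cbilinear_mult]])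
  from this[of "\<Delta> a"] have "star (tensor_lift (\<lambda>x y. y * \<sigma> x) (\<Delta> a)) = cnj (\<epsilon> a) *\<^sub>C 1"
    by (simp add: antipode_left counit_star flip: comult_star)
  then show ?thesis
    by (metis star_star star_scaleC star_one complex_cnj_cnj)
qed

text \<open>The scalar \<epsilon>(a_1) passes from the fixed vector \<open>k\<close> to the second
  factor, where the counit law recovers \<open>a\<close>.\<close>

lemma counit_tensor_left: "tensor_map (\<lambda>x. \<epsilon> x *\<^sub>C k) id (\<Delta> a) = k \<otimes>\<^sub>t a"
proof -
  have k: "clinear (\<lambda>x. \<epsilon> x *\<^sub>C k)"
    by (rule clinear_compose[OF linear_counit clinear_cbilinear_left[OF cbilinear_scaleC]])
  have "tensor_map (\<lambda>x. \<epsilon> x *\<^sub>C k) id t = k \<otimes>\<^sub>t tensor_lift (\<lambda>c x. c *\<^sub>C x) (tensor_map \<epsilon> id t)"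
    for t :: "('a, 'a) tensor"
    by (induction t) (simp_all add: k tensor_map_tensor linear_counit clinear_id tensor_map_add
        tensor_lift_cbilinear[OF cbilinear_scaleC] tensor_scaleC_left tensor_scaleC_right
        clinear_add[OF clinear_tensor_lift[OF cbilinear_scaleC]] tensor_add_right)
  then show ?thesis by (simp add: counit_left)
qed

lemma counit_tensor_right: "tensor_map id (\<lambda>x. \<epsilon> x *\<^sub>C k) (\<Delta> a) = a \<otimes>\<^sub>t k"
proof -
  have k: "clinear (\<lambda>x. \<epsilon> x *\<^sub>C k)"
    by (rule clinear_compose[OF linear_counit clinear_cbilinear_left[OF cbilinear_scaleC]])
  have "tensor_map id (\<lambda>x. \<epsilon> x *\<^sub>C k) t = tensor_lift (\<lambda>x c. c *\<^sub>C x) (tensor_map id \<epsilon> t) \<otimes>\<^sub>t k"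
    for t :: "('a, 'a) tensor"
    by (induction t) (simp_all add: k tensor_map_tensor linear_counit clinear_id tensor_map_add
        tensor_lift_cbilinear[OF cbilinear_scaleC_flip] tensor_scaleC_left tensor_scaleC_right
        clinear_add[OF clinear_tensor_lift[OF cbilinear_scaleC_flip]] tensor_add_left)
  then show ?thesis by (simp add: counit_right)
qed

section \<open>From star-subalgebra coideals to embeddable spaces\<close>

text \<open>With \<Delta> as coaction, the coaction axioms are coassociativity and the counit law,
  and compatibility with the inclusion is immediate.\<close>

lemma left_embeddable_homogeneous_space_inclusion:
  assumes "star_subalgebra star B" "right_coideal \<Delta> B"
  shows "left_embeddable_homogeneous_space \<Delta> \<epsilon> star star B \<Delta> id"
  using assms by (simp add: left_embeddable_homogeneous_space_def right_coaction_on_def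
      star_embedding_on_def right_coideal_def star_algebra_axioms linear_comult coassoc counit_right
      clinear_id tensor_map_id)

lemma right_embeddable_homogeneous_space_inclusion:
  assumes "star_subalgebra star B" "left_coideal \<Delta> B"
  shows "right_embeddable_homogeneous_space \<Delta> \<epsilon> star star B \<Delta> id"
  using assms by (simp add: right_embeddable_homogeneous_space_def left_coaction_on_def
      star_embedding_on_def left_coideal_def star_algebra_axioms linear_comult coassoc counit_left
      clinear_id tensor_map_id)

end

section \<open>Coisotropic left subgroups\<close>

context real_coisotropic_left_subgroup
begin

section \<open>Coinvariants of a left subgroup as a right coideal\<close>

text \<open>The kernel form gives the subspace property at once and makes
  \<open>tensor_kernel_left\<close> applicable for the coideal property.\<close>

lemma B_sub_kernel: "B_sub \<Delta> \<pi> = {a. tensor_map \<pi> id (\<Delta> a) - \<pi> 1 \<otimes>\<^sub>t a = 0}"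
  by (simp add: B_sub_def)

lemma clinear_coinvariance_defect: "clinear (\<lambda>a. tensor_map \<pi> id (\<Delta> a) - \<pi> 1 \<otimes>\<^sub>t a)"
  by (intro clinear_diff clinear_compose[OF linear_comult] clinear_tensor_map linear_morphism
      clinear_id clinear_tensor_right)

lemma subspace_B_sub: "complex_vector.subspace (B_sub \<Delta> \<pi>)"
  unfolding B_sub_kernel by (rule complex_vector.linear_subspace_kernel[OF clinear_coinvariance_defect])

text \<open>Apply \<Delta> to the second factor of the coinvariance equation and reassociate: both
  sides become \<open>\<pi> 1 \<otimes>\<^sub>t \<Delta> a\<close>. Both the coideal property and
  star stability rest on this.\<close>

lemma comult_B_sub_assoc:
  assumes "a \<in> B_sub \<Delta> \<pi>"
  shows "tensor_map (\<lambda>x. tensor_map \<pi> id (\<Delta> x)) id (\<Delta> a) = tensor_map (\<lambda>x. \<pi> 1 \<otimes>\<^sub>t x) id (\<Delta> a)"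
proof -
  have "tensor_assoc (tensor_map (\<lambda>x. tensor_map \<pi> id (\<Delta> x)) id (\<Delta> a))
      = tensor_assoc (tensor_map (tensor_map \<pi> id) id (tensor_map \<Delta> id (\<Delta> a)))"
    by (simp add: tensor_map_compose linear_comult clinear_id clinear_tensor_map linear_morphism id_def[symmetric])
  also have "\<dots> = tensor_map \<pi> id (tensor_map id \<Delta> (\<Delta> a))"
    by (simp add: tensor_assoc_natural linear_morphism clinear_id coassoc tensor_map_id[abs_def] id_def[symmetric])
  \<comment> \<open>The maps \<pi> and \<Delta> act on different factors and therefore commute,
    which exposes the coinvariance hypothesis.\<close>
  also have "\<dots> = tensor_map id \<Delta> (tensor_map \<pi> id (\<Delta> a))"
    by (simp add: tensor_map_compose linear_comult clinear_id linear_morphism)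
  also have "\<dots> = \<pi> 1 \<otimes>\<^sub>t \<Delta> a"
    using assms by (simp add: B_sub_def tensor_map_tensor clinear_id linear_comult)
  also have "\<dots> = tensor_assoc (tensor_map (\<lambda>x. \<pi> 1 \<otimes>\<^sub>t x) id (\<Delta> a))"
    by (simp add: tensor_assoc_map_tensor)
  finally show ?thesis by (simp only: tensor_assoc_inject)
qed

lemma right_coideal_B_sub: "right_coideal \<Delta> (B_sub \<Delta> \<pi>)"
proof -
  have "\<Delta> a \<in> tensor_subspace (B_sub \<Delta> \<pi>) UNIV" if "a \<in> B_sub \<Delta> \<pi>" for a
    unfolding B_sub_kernel
  proof (rule tensor_kernel_left[OF clinear_coinvariance_defect])
    show "tensor_map (\<lambda>x. tensor_map \<pi> id (\<Delta> x) - \<pi> 1 \<otimes>\<^sub>t x) id (\<Delta> a) = 0"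
      using comult_B_sub_assoc[OF that] by (simp add: tensor_map_diff_left clinear_tensor_right clinear_id
          clinear_compose[OF linear_comult clinear_tensor_map[OF linear_morphism clinear_id]])
  qed
  then show ?thesis by (auto simp: right_coideal_def subspace_B_sub)
qed

section \<open>Unit and products of left coinvariants\<close>

lemma one_B_sub: "1 \<in> B_sub \<Delta> \<pi>"
  by (simp add: B_sub_def comult_one one_tensor_def tensor_map_tensor linear_morphism clinear_id)

text \<open>The projection is only a module map, so \<Delta>(x) is made to act on (\<pi> \<otimes>
  id)\<Delta>(y) = \<pi>(1) \<otimes> y. This yields \<pi>(x_1) \<otimes> x_2 y, and coinvariance of
  \<open>x\<close> turns it into \<pi>(1) \<otimes> xy.\<close>

lemma mult_B_sub:
  assumes x: "x \<in> B_sub \<Delta> \<pi>" and y: "y \<in> B_sub \<Delta> \<pi>"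
  shows "x * y \<in> B_sub \<Delta> \<pi>"
proof -
  have act: "clinear (act u)" for u
    using bilinear_act by (rule clinear_cbilinear_right)
  note lin = clinear_add[OF clinear_cbilinear_left[OF bilinear_act]]
    clinear_scaleC[OF clinear_cbilinear_left[OF bilinear_act]]
  \<comment> \<open>Bilinearity in the acting pair extends the factorwise action from pure tensors
    \<open>u \<otimes>\<^sub>t v\<close> to all tensors, in particular to
    \<open>\<Delta> x\<close>.\<close>
  have b: "cbilinear (\<lambda>u v. tensor_map (act u) ((*) v) t)" for t :: "('k, 'a) tensor"
  proof -
    have "tensor_map (act (u + u')) ((*) v) t = tensor_map (act u) ((*) v) t + tensor_map (act u') ((*) v) t"
      for u u' v
      by (induction t) (simp_all add: tensor_map_tensor act clinear_mult
          tensor_map_add tensor_add_left clinear_plus lin)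
    moreover have "tensor_map (act (c *\<^sub>C u)) ((*) v) t = c *\<^sub>C tensor_map (act u) ((*) v) t" for c u v
      by (induction t) (simp_all add: tensor_map_tensor act clinear_mult
          tensor_map_add tensor_scaleC_left clinear_scale lin scaleC_add_right)
    moreover have "tensor_map (act u) ((*) (v + v')) t = tensor_map (act u) ((*) v) t + tensor_map (act u) ((*) v') t"
      for u v v'
      by (induction t) (simp_all add: tensor_map_tensor act clinear_mult
          tensor_map_add tensor_add_right distrib_right clinear_plus)
    moreover have "tensor_map (act u) ((*) (c *\<^sub>C v)) t = c *\<^sub>C tensor_map (act u) ((*) v) t" for c u v
      by (induction t) (simp_all add: tensor_map_tensor act clinear_mult
          tensor_map_add tensor_scaleC_right mult_scaleC_left scaleC_add_right clinear_scale)
    ultimately show ?thesis by (simp add: cbilinear_def clinear_iff)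
  qed
  have pure: "tensor_map \<pi> id ((u \<otimes>\<^sub>t v) * t) = tensor_map (act u) ((*) v) (tensor_map \<pi> id t)" for u v t
    by (induction t) (simp_all add: tensor_mult_tensor tensor_map_tensor linear_morphism clinear_id act
        clinear_mult projection_act distrib_left tensor_map_add)
  have "tensor_map \<pi> id (s * t) = tensor_lift (\<lambda>u v. tensor_map (act u) ((*) v) (tensor_map \<pi> id t)) s"
    for s t :: "('a, 'a) tensor"
  proof (rule tensor_clinear_eqI[where h = "\<lambda>s. tensor_map \<pi> id (s * t)"])
    show "clinear (\<lambda>s. tensor_map \<pi> id (s * t))"
      by (rule clinear_compose[OF clinear_cbilinear_left[OF cbilinear_mult]
            clinear_tensor_map[OF linear_morphism clinear_id]])
    show "clinear (tensor_lift (\<lambda>u v. tensor_map (act u) ((*) v) (tensor_map \<pi> id t)))"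
      by (rule clinear_tensor_lift[OF b])
    show "tensor_map \<pi> id ((u \<otimes>\<^sub>t v) * t)
        = tensor_lift (\<lambda>u v. tensor_map (act u) ((*) v) (tensor_map \<pi> id t)) (u \<otimes>\<^sub>t v)" for u v
      by (simp only: pure tensor_lift_cbilinear[OF b])
  qed
  then have "tensor_map \<pi> id (\<Delta> (x * y)) = tensor_lift (\<lambda>u v. tensor_map (act u) ((*) v) (\<pi> 1 \<otimes>\<^sub>t y)) (\<Delta> x)"
    using y by (simp add: comult_mult B_sub_def)
  also have "\<dots> = tensor_map id (\<lambda>v. v * y) (tensor_map \<pi> id (\<Delta> x))"
  proof -
    have m: "clinear (\<lambda>v. v * y)" by (rule clinear_cbilinear_left[OF cbilinear_mult])
    have p: "act u (\<pi> 1) = \<pi> u" for u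
      using projection_act[of u 1] by (simp only: mult_1_right)
    have "tensor_map (act u) ((*) v) (\<pi> 1 \<otimes>\<^sub>t y) = \<pi> u \<otimes>\<^sub>t (v * y)" for u v
      by (simp only: tensor_map_tensor act clinear_mult p)
    then have "tensor_lift (\<lambda>u v. tensor_map (act u) ((*) v) (\<pi> 1 \<otimes>\<^sub>t y)) (\<Delta> x)
        = tensor_map \<pi> (\<lambda>v. v * y) (\<Delta> x)"
      by (simp only: tensor_map_def)
    then show ?thesis
      by (simp add: tensor_map_compose linear_morphism clinear_id m)
  qed
  also have "\<dots> = \<pi> 1 \<otimes>\<^sub>t (x * y)"
    using x by (simp add: B_sub_def tensor_map_tensor clinear_id clinear_cbilinear_left[OF cbilinear_mult])
  finally show ?thesis by (simp add: B_sub_def)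
qed

section \<open>Star stability of left coinvariants\<close>

lemma twisted_antipode_B_sub:
  assumes a: "a \<in> B_sub \<Delta> \<pi>"
  shows "tensor_map (\<lambda>x. \<pi> (\<sigma> x)) id (\<Delta> a) = \<pi> 1 \<otimes>\<^sub>t a"
proof -
  note lin = linear_morphism clinear_id linear_comult clinear_twisted_antipode
  have b: "cbilinear (\<lambda>k y. act (\<sigma> y) k)"
    using cbilinear_flip[OF cbilinear_compose[OF bilinear_act clinear_twisted_antipode clinear_id clinear_id]]
    by simp
  \<comment> \<open>This contraction sends \<pi>(x_1) \<otimes> x_2 to \<pi>(\<sigma>(x_2) x_1) =
    \<epsilon>(x) \<pi>(1), but \<pi>(1) \<otimes> x to \<pi>(\<sigma>(x)). Applied to the first two
    factors in \<open>comult_B_sub_assoc\<close>, it yields the two sides of the claim.\<close>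
  let ?L = "tensor_lift (\<lambda>k y. act (\<sigma> y) k)"
  have L: "clinear ?L" by (rule clinear_tensor_lift[OF b])
  have b': "cbilinear (\<lambda>x y. \<sigma> y * x)"
    using cbilinear_flip[OF cbilinear_compose[OF cbilinear_mult clinear_twisted_antipode clinear_id clinear_id]]
    by simp
  have L_comult: "?L (tensor_map \<pi> id (\<Delta> x)) = \<epsilon> x *\<^sub>C \<pi> 1" for x
    using clinear_tensor_lift_comp[OF b' linear_morphism, of "\<Delta> x"]
    by (simp add: tensor_lift_tensor_map[OF b] lin twisted_antipode_left clinear_scaleC projection_act)
  have "\<pi> 1 \<otimes>\<^sub>t a = tensor_map (\<lambda>x. ?L (tensor_map \<pi> id (\<Delta> x))) id (\<Delta> a)"
    by (simp add: L_comult counit_tensor_left)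
  also have "\<dots> = tensor_map ?L id (tensor_map (\<lambda>x. tensor_map \<pi> id (\<Delta> x)) id (\<Delta> a))"
    by (simp add: tensor_map_compose L lin clinear_compose[OF linear_comult] clinear_tensor_map id_def[symmetric])
  also have "\<dots> = tensor_map (\<lambda>x. ?L (\<pi> 1 \<otimes>\<^sub>t x)) id (\<Delta> a)"
    by (simp add: comult_B_sub_assoc[OF a] tensor_map_compose L clinear_tensor_right clinear_id id_def[symmetric])
  also have "(\<lambda>x. ?L (\<pi> 1 \<otimes>\<^sub>t x)) = (\<lambda>x. \<pi> (\<sigma> x))"
    by (simp add: tensor_lift_cbilinear[OF b] flip: projection_act)
  finally show ?thesis by (rule sym)
qed

lemma star_B_sub:
  assumes a: "a \<in> B_sub \<Delta> \<pi>"
  shows "star a \<in> B_sub \<Delta> \<pi>"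
proof -
  have tau: "\<tau>\<^sub>K (\<pi> x) = \<pi> (hopf_tau S star x)" for x
    using fun_cong[OF tau_projection, of x] by simp
  have p: "clinear (\<lambda>x. \<pi> (\<sigma> x))"
    by (rule clinear_compose[OF clinear_twisted_antipode linear_morphism])
  \<comment> \<open>On first factors this is \<open>\<tau>\<^sub>K \<circ> \<pi> \<circ> \<sigma> =
    \<pi> \<circ> star\<close>. Both sides are antilinear in \<open>t\<close>, so they are compared
    by additive induction on tensors.\<close>
  have "tensor_map \<pi> id (tensor_map star star t) = tensor_map \<tau>\<^sub>K star (tensor_map (\<lambda>x. \<pi> (\<sigma> x)) id t)" for t
    by (induction t) (simp_all add: tensor_map_tensor tensor_map_tensor_antilinear antilinear_star antilinear_tau
        linear_morphism clinear_id p tau tau_star tensor_map_add tensor_map_add_antilinear)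
  then show ?thesis
    by (simp add: B_sub_def comult_star twisted_antipode_B_sub[OF a] tensor_map_tensor_antilinear
        antilinear_star antilinear_tau tau tau_one)
qed

lemma star_subalgebra_B_sub: "star_subalgebra star (B_sub \<Delta> \<pi>)"
  by (simp add: star_subalgebra_def subspace_B_sub one_B_sub mult_B_sub star_B_sub)

end

section \<open>Coisotropic right subgroups\<close>

context real_coisotropic_right_subgroup
begin

section \<open>Coinvariants of a right subgroup as a left coideal\<close>

lemma B_sup_kernel: "B_sup \<Delta> \<pi> = {a. tensor_map id \<pi> (\<Delta> a) - a \<otimes>\<^sub>t \<pi> 1 = 0}"
  by (simp add: B_sup_def)

lemma clinear_coinvariance_defect: "clinear (\<lambda>a. tensor_map id \<pi> (\<Delta> a) - a \<otimes>\<^sub>t \<pi> 1)"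
  by (intro clinear_diff clinear_compose[OF linear_comult] clinear_tensor_map linear_morphism
      clinear_id clinear_tensor_left)

lemma subspace_B_sup: "complex_vector.subspace (B_sup \<Delta> \<pi>)"
  unfolding B_sup_kernel by (rule complex_vector.linear_subspace_kernel[OF clinear_coinvariance_defect])

text \<open>Mirror image: \<Delta> is applied to the first factor of the coinvariance equation. Both
  sides already carry the bracketing that \<open>tensor_assoc\<close> produces, so the chain runs
  directly between them.\<close>

lemma comult_B_sup_assoc:
  assumes "a \<in> B_sup \<Delta> \<pi>"
  shows "tensor_map id (\<lambda>x. tensor_map id \<pi> (\<Delta> x)) (\<Delta> a) = tensor_map id (\<lambda>x. x \<otimes>\<^sub>t \<pi> 1) (\<Delta> a)"
proof -
  have "tensor_map id (\<lambda>x. tensor_map id \<pi> (\<Delta> x)) (\<Delta> a)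
      = tensor_map id (tensor_map id \<pi>) (tensor_map id \<Delta> (\<Delta> a))"
    by (simp add: tensor_map_compose linear_comult clinear_id clinear_tensor_map linear_morphism id_def[symmetric])
  also have "\<dots> = tensor_assoc (tensor_map id \<pi> (tensor_map \<Delta> id (\<Delta> a)))"
    using tensor_assoc_natural[OF clinear_id clinear_id linear_morphism, of "tensor_map \<Delta> id (\<Delta> a)"]
    by (simp add: coassoc tensor_map_id[abs_def] id_def[symmetric])
  also have "\<dots> = tensor_assoc (tensor_map \<Delta> id (tensor_map id \<pi> (\<Delta> a)))"
    by (simp add: tensor_map_compose linear_comult clinear_id linear_morphism)
  also have "\<dots> = tensor_assoc (\<Delta> a \<otimes>\<^sub>t \<pi> 1)"
    using assms by (simp add: B_sup_def tensor_map_tensor clinear_id linear_comult)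
  finally show ?thesis by (simp only: tensor_assoc_tensor_right)
qed

lemma left_coideal_B_sup: "left_coideal \<Delta> (B_sup \<Delta> \<pi>)"
proof -
  have "\<Delta> a \<in> tensor_subspace UNIV (B_sup \<Delta> \<pi>)" if "a \<in> B_sup \<Delta> \<pi>" for a
    unfolding B_sup_kernel
  proof (rule tensor_kernel_right[OF clinear_coinvariance_defect])
    show "tensor_map id (\<lambda>x. tensor_map id \<pi> (\<Delta> x) - x \<otimes>\<^sub>t \<pi> 1) (\<Delta> a) = 0"
      using comult_B_sup_assoc[OF that] by (simp add: tensor_map_diff_right clinear_tensor_left clinear_id
          clinear_compose[OF linear_comult clinear_tensor_map[OF clinear_id linear_morphism]])
  qed
  then show ?thesis by (auto simp: left_coideal_def subspace_B_sup)
qed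

section \<open>Unit and products of right coinvariants\<close>

lemma one_B_sup: "1 \<in> B_sup \<Delta> \<pi>"
  by (simp add: B_sup_def comult_one one_tensor_def tensor_map_tensor linear_morphism clinear_id)

text \<open>Now \<Delta>(y) acts from the right on (id \<otimes> \<pi>)\<Delta>(x) = x \<otimes>
  \<pi>(1). The result x y_1 \<otimes> \<pi>(y_2) equals xy \<otimes> \<pi>(1) by coinvariance of
  \<open>y\<close>.\<close>

lemma mult_B_sup:
  assumes x: "x \<in> B_sup \<Delta> \<pi>" and y: "y \<in> B_sup \<Delta> \<pi>"
  shows "x * y \<in> B_sup \<Delta> \<pi>"
proof -
  \<comment> \<open>Right multiplication and right action are indexed by the acting element, so that
    they can be used as factors of \<open>tensor_map\<close>.\<close>
  let ?r = "\<lambda>v u. u * (v :: 'a)" and ?a = "\<lambda>v k. act k v"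
  have act: "clinear (?a v)" for v
    using bilinear_act by (rule clinear_cbilinear_left)
  have r: "clinear (?r v)" for v
    by (rule clinear_cbilinear_left[OF cbilinear_mult])
  note lin = clinear_add[OF clinear_cbilinear_right[OF bilinear_act]]
    clinear_scaleC[OF clinear_cbilinear_right[OF bilinear_act]]
  have b: "cbilinear (\<lambda>u v. tensor_map (?r u) (?a v) t)" for t :: "('a, 'k) tensor"
  proof -
    have "tensor_map (?r u) (?a (v + v')) t = tensor_map (?r u) (?a v) t + tensor_map (?r u) (?a v') t"
      for u v v'
      by (induction t) (simp_all add: tensor_map_tensor act r
          tensor_map_add tensor_add_right clinear_plus lin)
    moreover have "tensor_map (?r u) (?a (c *\<^sub>C v)) t = c *\<^sub>C tensor_map (?r u) (?a v) t" for c u v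
      by (induction t) (simp_all add: tensor_map_tensor act r
          tensor_map_add tensor_scaleC_right clinear_scale lin scaleC_add_right)
    moreover have "tensor_map (?r (u + u')) (?a v) t = tensor_map (?r u) (?a v) t + tensor_map (?r u') (?a v) t"
      for u u' v
      by (induction t) (simp_all add: tensor_map_tensor act r
          tensor_map_add tensor_add_left distrib_left clinear_plus)
    moreover have "tensor_map (?r (c *\<^sub>C u)) (?a v) t = c *\<^sub>C tensor_map (?r u) (?a v) t" for c u v
      by (induction t) (simp_all add: tensor_map_tensor act r
          tensor_map_add tensor_scaleC_left mult_scaleC_right scaleC_add_right clinear_scale)
    ultimately show ?thesis by (simp add: cbilinear_def clinear_iff)
  qed
  have pure: "tensor_map id \<pi> (s * (u \<otimes>\<^sub>t v)) = tensor_map (?r u) (?a v) (tensor_map id \<pi> s)" for u v s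
    by (induction s) (simp_all add: tensor_mult_tensor tensor_map_tensor linear_morphism clinear_id act
        r projection_act distrib_right tensor_map_add)
  have "tensor_map id \<pi> (s * t) = tensor_lift (\<lambda>u v. tensor_map (?r u) (?a v) (tensor_map id \<pi> s)) t"
    for s t :: "('a, 'a) tensor"
  proof (rule tensor_clinear_eqI[where h = "\<lambda>t. tensor_map id \<pi> (s * t)"])
    show "clinear (\<lambda>t. tensor_map id \<pi> (s * t))"
      by (rule clinear_compose[OF clinear_mult clinear_tensor_map[OF clinear_id linear_morphism]])
    show "clinear (tensor_lift (\<lambda>u v. tensor_map (?r u) (?a v) (tensor_map id \<pi> s)))"
      by (rule clinear_tensor_lift[OF b])
    show "tensor_map id \<pi> (s * (u \<otimes>\<^sub>t v))
        = tensor_lift (\<lambda>u v. tensor_map (?r u) (?a v) (tensor_map id \<pi> s)) (u \<otimes>\<^sub>t v)" for u v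
      by (simp only: pure tensor_lift_cbilinear[OF b])
  qed
  then have "tensor_map id \<pi> (\<Delta> (x * y)) = tensor_lift (\<lambda>u v. tensor_map (?r u) (?a v) (x \<otimes>\<^sub>t \<pi> 1)) (\<Delta> y)"
    using x by (simp add: comult_mult B_sup_def)
  also have "\<dots> = tensor_map ((*) x) id (tensor_map id \<pi> (\<Delta> y))"
  proof -
    have p: "act (\<pi> 1) v = \<pi> v" for v
      using projection_act[of 1 v] by (simp only: mult_1_left)
    have "tensor_map (?r u) (?a v) (x \<otimes>\<^sub>t \<pi> 1) = (x * u) \<otimes>\<^sub>t \<pi> v" for u v
      by (simp only: tensor_map_tensor act r p)
    then have "tensor_lift (\<lambda>u v. tensor_map (?r u) (?a v) (x \<otimes>\<^sub>t \<pi> 1)) (\<Delta> y)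
        = tensor_map ((*) x) \<pi> (\<Delta> y)"
      by (simp only: tensor_map_def)
    then show ?thesis
      by (simp add: tensor_map_compose linear_morphism clinear_id clinear_mult)
  qed
  also have "\<dots> = (x * y) \<otimes>\<^sub>t \<pi> 1"
    using y by (simp add: B_sup_def tensor_map_tensor clinear_id clinear_mult)
  finally show ?thesis by (simp add: B_sup_def)
qed

section \<open>Star stability of right coinvariants\<close>

lemma twisted_antipode_B_sup:
  assumes a: "a \<in> B_sup \<Delta> \<pi>"
  shows "tensor_map id (\<lambda>x. \<pi> (\<sigma> x)) (\<Delta> a) = a \<otimes>\<^sub>t \<pi> 1"
proof -
  note lin = linear_morphism clinear_id linear_comult clinear_twisted_antipode
  have b: "cbilinear (\<lambda>y k. act k (\<sigma> y))"
    using cbilinear_flip[OF cbilinear_compose[OF bilinear_act clinear_id clinear_twisted_antipode clinear_id]]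
    by simp
  \<comment> \<open>Contracts x_1 \<otimes> \<pi>(x_2) to \<pi>(x_2 \<sigma>(x_1)) = \<epsilon>(x)
    \<pi>(1), and x \<otimes> \<pi>(1) to \<pi>(\<sigma>(x)); here the second identity for \<sigma>
    is used.\<close>
  let ?L = "tensor_lift (\<lambda>y k. act k (\<sigma> y))"
  have L: "clinear ?L" by (rule clinear_tensor_lift[OF b])
  have b': "cbilinear (\<lambda>x y. y * \<sigma> x)"
    using cbilinear_flip[OF cbilinear_compose[OF cbilinear_mult clinear_id clinear_twisted_antipode clinear_id]]
    by simp
  have L_comult: "?L (tensor_map id \<pi> (\<Delta> x)) = \<epsilon> x *\<^sub>C \<pi> 1" for x
    using clinear_tensor_lift_comp[OF b' linear_morphism, of "\<Delta> x"]
    by (simp add: tensor_lift_tensor_map[OF b] lin twisted_antipode_right clinear_scaleC projection_act)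
  have "a \<otimes>\<^sub>t \<pi> 1 = tensor_map id (\<lambda>x. ?L (tensor_map id \<pi> (\<Delta> x))) (\<Delta> a)"
    by (simp add: L_comult counit_tensor_right)
  also have "\<dots> = tensor_map id ?L (tensor_map id (\<lambda>x. tensor_map id \<pi> (\<Delta> x)) (\<Delta> a))"
    by (simp add: tensor_map_compose L lin clinear_compose[OF linear_comult] clinear_tensor_map id_def[symmetric])
  also have "\<dots> = tensor_map id (\<lambda>x. ?L (x \<otimes>\<^sub>t \<pi> 1)) (\<Delta> a)"
    by (simp add: comult_B_sup_assoc[OF a] tensor_map_compose L clinear_tensor_left clinear_id id_def[symmetric])
  also have "(\<lambda>x. ?L (x \<otimes>\<^sub>t \<pi> 1)) = (\<lambda>x. \<pi> (\<sigma> x))"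
    by (simp add: tensor_lift_cbilinear[OF b] flip: projection_act)
  finally show ?thesis by (rule sym)
qed

text \<open>The antilinear map \<open>star \<otimes> \<tau>\<^sub>K\<close> carries the preceding
  identity to the coinvariance equation of \<open>star a\<close>, because \<open>\<tau>\<^sub>K
  \<circ> \<pi> \<circ> \<sigma> = \<pi> \<circ> star\<close>.\<close>

lemma star_B_sup:
  assumes a: "a \<in> B_sup \<Delta> \<pi>"
  shows "star a \<in> B_sup \<Delta> \<pi>"
proof -
  have tau: "\<tau>\<^sub>K (\<pi> x) = \<pi> (hopf_tau S star x)" for x
    using fun_cong[OF tau_projection, of x] by simp
  have p: "clinear (\<lambda>x. \<pi> (\<sigma> x))"
    by (rule clinear_compose[OF clinear_twisted_antipode linear_morphism])
  have "tensor_map id \<pi> (tensor_map star star t) = tensor_map star \<tau>\<^sub>K (tensor_map id (\<lambda>x. \<pi> (\<sigma> x)) t)" for t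
    by (induction t) (simp_all add: tensor_map_tensor tensor_map_tensor_antilinear antilinear_star antilinear_tau
        linear_morphism clinear_id p tau tau_star tensor_map_add tensor_map_add_antilinear)
  then show ?thesis
    by (simp add: B_sup_def comult_star twisted_antipode_B_sup[OF a] tensor_map_tensor_antilinear
        antilinear_star antilinear_tau tau tau_one)
qed

lemma star_subalgebra_B_sup: "star_subalgebra star (B_sup \<Delta> \<pi>)"
  by (simp add: star_subalgebra_def subspace_B_sup one_B_sup mult_B_sup star_B_sup)

end

theorem proposition2p5:
  fixes \<Delta> :: "'a::complex_algebra_1 \<Rightarrow> ('a, 'a) tensor" and \<epsilon> :: "'a \<Rightarrow> complex"
    and S :: "'a \<Rightarrow> 'a" and star :: "'a \<Rightarrow> 'a"
    and \<Delta>\<^sub>K :: "'k::complex_vector \<Rightarrow> ('k, 'k) tensor" and \<epsilon>\<^sub>K :: "'k \<Rightarrow> complex"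
    and act\<^sub>K :: "'a \<Rightarrow> 'k \<Rightarrow> 'k" and \<pi>\<^sub>K :: "'a \<Rightarrow> 'k" and \<tau>\<^sub>K :: "'k \<Rightarrow> 'k"
    and \<Delta>\<^sub>L :: "'l::complex_vector \<Rightarrow> ('l, 'l) tensor" and \<epsilon>\<^sub>L :: "'l \<Rightarrow> complex"
    and act\<^sub>L :: "'l \<Rightarrow> 'a \<Rightarrow> 'l" and \<pi>\<^sub>L :: "'a \<Rightarrow> 'l" and \<tau>\<^sub>L :: "'l \<Rightarrow> 'l"
  assumes "real_quantum_group \<Delta> \<epsilon> S star"
  shows "(real_coisotropic_left_subgroup \<Delta> \<epsilon> S star \<Delta>\<^sub>K \<epsilon>\<^sub>K act\<^sub>K \<pi>\<^sub>K \<tau>\<^sub>K \<longrightarrow>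
            left_embeddable_homogeneous_space \<Delta> \<epsilon> star star (B_sub \<Delta> \<pi>\<^sub>K) \<Delta> id \<and>
            star_subalgebra star (B_sub \<Delta> \<pi>\<^sub>K) \<and> right_coideal \<Delta> (B_sub \<Delta> \<pi>\<^sub>K)) \<and>
         (real_coisotropic_right_subgroup \<Delta> \<epsilon> S star \<Delta>\<^sub>L \<epsilon>\<^sub>L act\<^sub>L \<pi>\<^sub>L \<tau>\<^sub>L \<longrightarrow>
            right_embeddable_homogeneous_space \<Delta> \<epsilon> star star (B_sup \<Delta> \<pi>\<^sub>L) \<Delta> id \<and>
            star_subalgebra star (B_sup \<Delta> \<pi>\<^sub>L) \<and> left_coideal \<Delta> (B_sup \<Delta> \<pi>\<^sub>L))"
proof (intro conjI impI)
  assume "real_coisotropic_left_subgroup \<Delta> \<epsilon> S star \<Delta>\<^sub>K \<epsilon>\<^sub>K act\<^sub>K \<pi>\<^sub>K \<tau>\<^sub>K"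
  then interpret real_coisotropic_left_subgroup \<Delta> \<epsilon> S star \<Delta>\<^sub>K \<epsilon>\<^sub>K act\<^sub>K \<pi>\<^sub>K \<tau>\<^sub>K .
  show "star_subalgebra star (B_sub \<Delta> \<pi>\<^sub>K)" "right_coideal \<Delta> (B_sub \<Delta> \<pi>\<^sub>K)"
    by (rule star_subalgebra_B_sub right_coideal_B_sub)+
  then show "left_embeddable_homogeneous_space \<Delta> \<epsilon> star star (B_sub \<Delta> \<pi>\<^sub>K) \<Delta> id"
    by (rule left_embeddable_homogeneous_space_inclusion)
next
  assume "real_coisotropic_right_subgroup \<Delta> \<epsilon> S star \<Delta>\<^sub>L \<epsilon>\<^sub>L act\<^sub>L \<pi>\<^sub>L \<tau>\<^sub>L"
  then interpret real_coisotropic_right_subgroup \<Delta> \<epsilon> S star \<Delta>\<^sub>L \<epsilon>\<^sub>L act\<^sub>L \<pi>\<^sub>L \<tau>\<^sub>L .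
  show "star_subalgebra star (B_sup \<Delta> \<pi>\<^sub>L)" "left_coideal \<Delta> (B_sup \<Delta> \<pi>\<^sub>L)"
    by (rule star_subalgebra_B_sup left_coideal_B_sup)+
  then show "right_embeddable_homogeneous_space \<Delta> \<epsilon> star star (B_sup \<Delta> \<pi>\<^sub>L) \<Delta> id"
    by (rule right_embeddable_homogeneous_space_inclusion)
qed

end
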